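(* Let $\mathcal{G}$ be a $(\mathrm{tw},\omega)$-bounded graph class having a computable $(\mathrm{tw},\omega)$-binding function $f$. Then, for every positive integer $k$ there exists a robust polynomial-time algorithm for the List $k$-Coloring problem on graphs in $\mathcal{G}$.
   Context: All graphs are finite, simple and undirected. $\mathrm{tw}(G)$ is the treewidth and $\omega(G)$ the clique number of $G$. A graph class $\mathcal{G}$ is $(\mathrm{tw},\omega)$-bounded if there is a function $f:\mathbb{N}\to\mathbb{N}$ such that for every $G\in\mathcal{G}$ and every induced subgraph $G'$ of $G$, $\mathrm{tw}(G')\le f(\omega(G'))$; such an $f$ is a $(\mathrm{tw},\omega)$-binding function for $\mathcal{G}$. List $k$-Coloring: given a graph $G$ and for each vertex a list of available colors from $\{1,\dots,k\}$, decide whether $G$ has a proper vertex coloring assigning to each vertex a color from its list. An algorithm for a problem on graphs in $\mathcal{G}$ is robust if, given an arbitrary input graph $G$ (not promised to be in $\mathcal{G}$), it either correctly solves the problem on $G$ or correctly determines that $G\notin\mathcal{G}$; here the running time is polynomial in the input size for all input graphs, with $k$ fixed. *)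

theory Defs
  imports "Graph_Theory.Digraph_Component" "HOL-Computational_Algebra.Polynomial"
begin

section \<open>Graphs\<close>

text \<open>
  A finite simple undirected graph is a \<open>pair_graph\<close>: a finite loopfree digraph without parallel
  arcs whose arc relation is symmetric, an edge \<open>uv\<close> being the pair of arcs \<open>(u,v)\<close> and \<open>(v,u)\<close>.
\<close>

definition clique :: "'a pair_pre_digraph \<Rightarrow> 'a set \<Rightarrow> bool" where
  "clique G C \<longleftrightarrow> C \<subseteq> pverts G \<and> (\<forall>u\<in>C. \<forall>v\<in>C. u \<noteq> v \<longrightarrow> (u, v) \<in> parcs G)"

definition clique_number :: "'a pair_pre_digraph \<Rightarrow> nat" where
  "clique_number G = Max {card C | C. clique G C}"

text \<open>
  In a symmetric digraph, \<open>pre_digraph.cycle\<close> also holds of the closed walks \<open>u, v, u\<close> along a single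
  edge, so the library's \<open>forest\<close> and \<open>tree\<close> are not the undirected notions. The cycles of the
  undirected graph are those of length at least 3.
\<close>

definition undirected_tree :: "'a pair_pre_digraph \<Rightarrow> bool" where
  "undirected_tree T \<longleftrightarrow> pair_graph T \<and> connected (with_proj T) \<and>
     \<not> (\<exists>p. pre_digraph.cycle (with_proj T) p \<and> 3 \<le> length p)"

text \<open>Note that \<open>connected\<close> includes nonemptiness.\<close>

definition tree_decomposition ::
    "'a pair_pre_digraph \<Rightarrow> nat pair_pre_digraph \<Rightarrow> (nat \<Rightarrow> 'a set) \<Rightarrow> bool" where
  "tree_decomposition G T B \<longleftrightarrow> undirected_tree T \<and>
     (\<Union>t\<in>pverts T. B t) = pverts G \<and>
     (\<forall>(u, v)\<in>parcs G. \<exists>t\<in>pverts T. u \<in> B t \<and> v \<in> B t) \<and>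
     (\<forall>v\<in>pverts G. connected (with_proj T \<restriction> {t\<in>pverts T. v \<in> B t}))"

text \<open>The graph without vertices gets treewidth 0 (truncated subtraction) rather than -1.\<close>

definition width :: "nat pair_pre_digraph \<Rightarrow> (nat \<Rightarrow> 'a set) \<Rightarrow> nat" where
  "width T B = Max ((\<lambda>t. card (B t)) ` pverts T) - 1"

definition treewidth :: "'a pair_pre_digraph \<Rightarrow> nat" where
  "treewidth G = (LEAST w. \<exists>T B. tree_decomposition G T B \<and> width T B = w)"

text \<open>A graph class is a set \<open>\<G>\<close> of graphs; closure under isomorphism is not required.\<close>

definition graph_class :: "'a pair_pre_digraph set \<Rightarrow> bool" where
  "graph_class \<G> \<longleftrightarrow> (\<forall>G\<in>\<G>. pair_graph G)"

definition tw_omega_binding_function :: "(nat \<Rightarrow> nat) \<Rightarrow> 'a pair_pre_digraph set \<Rightarrow> bool" where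
  "tw_omega_binding_function f \<G> \<longleftrightarrow>
     (\<forall>G\<in>\<G>. \<forall>G'. induced_subgraph (with_proj G') (with_proj G) \<longrightarrow>
        treewidth G' \<le> f (clique_number G'))"

definition tw_omega_bounded :: "'a pair_pre_digraph set \<Rightarrow> bool" where
  "tw_omega_bounded \<G> \<longleftrightarrow> (\<exists>f. tw_omega_binding_function f \<G>)"

definition list_colorable :: "'a pair_pre_digraph \<Rightarrow> ('a \<Rightarrow> nat set) \<Rightarrow> bool" where
  "list_colorable G L \<longleftrightarrow>
     (\<exists>c. (\<forall>v\<in>pverts G. c v \<in> L v) \<and> (\<forall>(u, v)\<in>parcs G. c u \<noteq> c v))"

definition list_coloring_instance ::
    "nat \<Rightarrow> 'a pair_pre_digraph \<Rightarrow> ('a \<Rightarrow> nat set) \<Rightarrow> bool" where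
  "list_coloring_instance k G L \<longleftrightarrow> pair_graph G \<and> (\<forall>v\<in>pverts G. L v \<subseteq> {1..k})"


section \<open>Model of computation\<close>

text \<open>
  The language WHILE of N. D. Jones (Computability and Complexity from a Programming Perspective,
  MIT Press 1997) over binary trees. It is Turing complete, and it decides in polynomial time exactly
  what Turing machines decide in polynomial time: implementing \<open>CONS\<close> by allocating a cell with two
  pointers, every operation below is a constant number of pointer manipulations. (There is
  deliberately no unit-cost equality test on trees.)
\<close>

datatype sexp = NIL | CONS sexp sexp

type_synonym store = "nat \<Rightarrow> sexp"

datatype expr = EVar nat | ENil | ECons expr expr | EHd expr | ETl expr

fun hd_sexp :: "sexp \<Rightarrow> sexp" where
  "hd_sexp NIL = NIL"
| "hd_sexp (CONS a b) = a"

fun tl_sexp :: "sexp \<Rightarrow> sexp" where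
  "tl_sexp NIL = NIL"
| "tl_sexp (CONS a b) = b"

fun eval_expr :: "expr \<Rightarrow> store \<Rightarrow> sexp" where
  "eval_expr (EVar x) s = s x"
| "eval_expr ENil s = NIL"
| "eval_expr (ECons a b) s = CONS (eval_expr a s) (eval_expr b s)"
| "eval_expr (EHd a) s = hd_sexp (eval_expr a s)"
| "eval_expr (ETl a) s = tl_sexp (eval_expr a s)"

fun expr_cost :: "expr \<Rightarrow> nat" where
  "expr_cost (EVar x) = 1"
| "expr_cost ENil = 1"
| "expr_cost (ECons a b) = 1 + expr_cost a + expr_cost b"
| "expr_cost (EHd a) = 1 + expr_cost a"
| "expr_cost (ETl a) = 1 + expr_cost a"

datatype com =
    Skip
  | Assign nat expr
  | Seq com com
  | If expr com com
  | While expr com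

text \<open>
  \<open>exec c s t s'\<close>: started in store \<open>s\<close>, the program \<open>c\<close> halts after time \<open>t\<close> in store \<open>s'\<close>.
  In tests, \<open>NIL\<close> is false and every other tree is true.
\<close>

inductive exec :: "com \<Rightarrow> store \<Rightarrow> nat \<Rightarrow> store \<Rightarrow> bool" where
  Skip: "exec Skip s 1 s"
| Assign: "exec (Assign x e) s (1 + expr_cost e) (s(x := eval_expr e s))"
| Seq: "exec c\<^sub>1 s t\<^sub>1 s' \<Longrightarrow> exec c\<^sub>2 s' t\<^sub>2 s'' \<Longrightarrow> exec (Seq c\<^sub>1 c\<^sub>2) s (t\<^sub>1 + t\<^sub>2) s''"
| IfTrue: "eval_expr b s \<noteq> NIL \<Longrightarrow> exec c\<^sub>1 s t s' \<Longrightarrow>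
    exec (If b c\<^sub>1 c\<^sub>2) s (1 + expr_cost b + t) s'"
| IfFalse: "eval_expr b s = NIL \<Longrightarrow> exec c\<^sub>2 s t s' \<Longrightarrow>
    exec (If b c\<^sub>1 c\<^sub>2) s (1 + expr_cost b + t) s'"
| WhileFalse: "eval_expr b s = NIL \<Longrightarrow> exec (While b c) s (1 + expr_cost b) s"
| WhileTrue: "eval_expr b s \<noteq> NIL \<Longrightarrow> exec c s t\<^sub>1 s' \<Longrightarrow> exec (While b c) s' t\<^sub>2 s'' \<Longrightarrow>
    exec (While b c) s (1 + expr_cost b + t\<^sub>1 + t\<^sub>2) s''"

inductive_cases exec_SkipE: "exec Skip s t s'"
  and exec_AssignE: "exec (Assign x e) s t s'"
  and exec_SeqE: "exec (Seq c\<^sub>1 c\<^sub>2) s t s'"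
  and exec_IfE: "exec (If b c\<^sub>1 c\<^sub>2) s t s'"
  and exec_WhileE: "exec (While b c) s t s'"

lemma exec_deterministic:
  "exec c s t s' \<Longrightarrow> exec c s u s'' \<Longrightarrow> t = u \<and> s' = s''"
proof (induction arbitrary: u s'' rule: exec.induct)
  case (Skip s)
  then show ?case by (auto elim: exec_SkipE)
next
  case (Assign x e s)
  then show ?case by (auto elim: exec_AssignE)
next
  case (Seq c\<^sub>1 s t\<^sub>1 s' c\<^sub>2 t\<^sub>2 s2)
  from Seq.prems obtain u\<^sub>1 r u\<^sub>2
    where u: "u = u\<^sub>1 + u\<^sub>2" and r: "exec c\<^sub>1 s u\<^sub>1 r" "exec c\<^sub>2 r u\<^sub>2 s''"
    by (rule exec_SeqE)
  have eq: "t\<^sub>1 = u\<^sub>1 \<and> s' = r" by (rule Seq.IH(1)[OF r(1)])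
  have "t\<^sub>2 = u\<^sub>2 \<and> s2 = s''" by (rule Seq.IH(2)) (simp add: eq r(2))
  with eq u show ?case by simp
next
  case (IfTrue b s c\<^sub>1 t s' c\<^sub>2)
  from IfTrue.prems IfTrue.hyps(1) obtain u\<^sub>1
    where u: "u = 1 + expr_cost b + u\<^sub>1" and r: "exec c\<^sub>1 s u\<^sub>1 s''"
    by (auto elim: exec_IfE)
  from IfTrue.IH[OF r] u show ?case by simp
next
  case (IfFalse b s c\<^sub>2 t s' c\<^sub>1)
  from IfFalse.prems IfFalse.hyps(1) obtain u\<^sub>1
    where u: "u = 1 + expr_cost b + u\<^sub>1" and r: "exec c\<^sub>2 s u\<^sub>1 s''"
    by (auto elim: exec_IfE)
  from IfFalse.IH[OF r] u show ?case by simp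
next
  case (WhileFalse b s c)
  then show ?case by (auto elim: exec_WhileE)
next
  case (WhileTrue b s c t\<^sub>1 s' t\<^sub>2 s2)
  from WhileTrue.prems obtain u\<^sub>1 r u\<^sub>2
    where u: "u = Suc (expr_cost b + u\<^sub>1 + u\<^sub>2)"
      and r: "exec c s u\<^sub>1 r" "exec (While b c) r u\<^sub>2 s''"
    by (rule exec_WhileE) (use WhileTrue.hyps(1) in auto)
  have eq: "t\<^sub>1 = u\<^sub>1 \<and> s' = r" by (rule WhileTrue.IH(1)[OF r(1)])
  have "t\<^sub>2 = u\<^sub>2 \<and> s2 = s''" by (rule WhileTrue.IH(2)) (simp add: eq r(2))
  with eq u show ?case by simp
qed

text \<open>Input and output are passed in variable 0; all other variables are initially \<open>NIL\<close>.\<close>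

definition run :: "com \<Rightarrow> sexp \<Rightarrow> nat \<Rightarrow> sexp \<Rightarrow> bool" where
  "run c x t y \<longleftrightarrow> (\<exists>s. exec c ((\<lambda>_. NIL)(0 := x)) t s \<and> s 0 = y)"

fun enc_list :: "sexp list \<Rightarrow> sexp" where
  "enc_list [] = NIL"
| "enc_list (x # xs) = CONS x (enc_list xs)"

fun enc_bool :: "bool \<Rightarrow> sexp" where
  "enc_bool False = NIL"
| "enc_bool True = CONS NIL NIL"

definition enc_nat :: "nat \<Rightarrow> sexp" where
  "enc_nat n = enc_list (replicate n NIL)"

definition computable :: "(nat \<Rightarrow> nat) \<Rightarrow> bool" where
  "computable f \<longleftrightarrow> (\<exists>c. \<forall>n. \<exists>t. run c (enc_nat n) t (enc_nat (f n)))"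


section \<open>Robust algorithms for List k-Coloring\<close>

text \<open>
  An instance is presented, relative to an arbitrary ordering \<open>vs\<close> of the vertices, by the adjacency
  matrix and, for each vertex, the characteristic bit vector of its list in \<open>{1..k}\<close>.
\<close>

definition vertex_ordering :: "'a pair_pre_digraph \<Rightarrow> 'a list \<Rightarrow> bool" where
  "vertex_ordering G vs \<longleftrightarrow> distinct vs \<and> set vs = pverts G"

definition enc_instance ::
    "nat \<Rightarrow> 'a pair_pre_digraph \<Rightarrow> ('a \<Rightarrow> nat set) \<Rightarrow> 'a list \<Rightarrow> sexp" where
  "enc_instance k G L vs = CONS
     (enc_list (map (\<lambda>u. enc_list (map (\<lambda>v. enc_bool ((u, v) \<in> parcs G)) vs)) vs))
     (enc_list (map (\<lambda>v. enc_list (map (\<lambda>i. enc_bool (i \<in> L v)) [1..<Suc k])) vs))"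

datatype answer = Yes | No | Not_In_Class

fun enc_answer :: "answer \<Rightarrow> sexp" where
  "enc_answer Yes = enc_nat 0"
| "enc_answer No = enc_nat 1"
| "enc_answer Not_In_Class = enc_nat 2"

fun correct_answer ::
    "'a pair_pre_digraph set \<Rightarrow> 'a pair_pre_digraph \<Rightarrow> ('a \<Rightarrow> nat set) \<Rightarrow> answer \<Rightarrow> bool" where
  "correct_answer \<G> G L Yes \<longleftrightarrow> list_colorable G L"
| "correct_answer \<G> G L No \<longleftrightarrow> \<not> list_colorable G L"
| "correct_answer \<G> G L Not_In_Class \<longleftrightarrow> G \<notin> \<G>"

definition robust_list_coloring_algorithm :: "nat \<Rightarrow> 'a pair_pre_digraph set \<Rightarrow> com \<Rightarrow> bool" where
  "robust_list_coloring_algorithm k \<G> c \<longleftrightarrow>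
     (\<forall>G L vs. list_coloring_instance k G L \<and> vertex_ordering G vs \<longrightarrow>
        (\<exists>t a. run c (enc_instance k G L vs) t (enc_answer a) \<and> correct_answer \<G> G L a))"

text \<open>The \<open>size\<close> of a tree is the number of its \<open>CONS\<close> cells.\<close>

definition polynomial_time_on :: "sexp set \<Rightarrow> com \<Rightarrow> bool" where
  "polynomial_time_on X c \<longleftrightarrow>
     (\<exists>p :: nat poly. \<forall>x\<in>X. \<exists>t y. run c x t y \<and> t \<le> poly p (size x))"

text \<open>
  The polynomial bound is over all instances, whether or not the graph belongs to the class. The
  argument of type \<open>'a itself\<close> only fixes the type of the vertices.
\<close>

definition list_coloring_inputs :: "'a itself \<Rightarrow> nat \<Rightarrow> sexp set" where
  "list_coloring_inputs _ k = {enc_instance k G L vs | (G :: 'a pair_pre_digraph) L vs.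
     list_coloring_instance k G L \<and> vertex_ordering G vs}"

end

theory Submission
  imports Defs
begin

text \<open>
  Fix \<open>k\<close>, let \<open>d = k + f 0 + \<dots> + f k + 1\<close> (a constant of the program), and call a pair of a vertex
  and a color an atom. The algorithm works with the \<open>d\<close>-tuples of atoms that respect the lists and
  give distinct colors to adjacent vertices, and repeatedly deletes every tuple in which, for some
  position and some vertex, no choice of a color for that vertex can be put at that position without
  leaving the current family. What remains is the greatest family that is \<open>extendable\<close>: the
  positions from which the second player survives in the existential \<open>d\<close>-pebble game. There are
  polynomially many \<open>d\<close>-tuples, so this takes polynomial time. The instance is called consistent if
  the family is nonempty.

  The tuples cut out of a list coloring form an extendable family, so an inconsistent instance of a
  nonempty graph has no list coloring, whatever the graph. The converse holds if the graph has a tree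
  decomposition with bags of at most \<open>d\<close> vertices: one colors the bags one after the other, along the
  tree, and keeps for every bag colored so far a tuple of the family that contains its coloring
  (\<open>extendable_tree_decomposition\<close>). Hence no tree decomposition is ever computed; its mere existence
  makes the answer of the consistency test right.

  On an arbitrary graph, consistency alone proves nothing. The algorithm therefore decides the atoms
  \<open>(v, i)\<close> one by one: it prescribes the color \<open>i\<close> for \<open>v\<close> if that keeps the instance consistent and
  forbids it otherwise. In the end every vertex has at most one color left, and if the instance is
  then still consistent these colors form a list coloring
  (\<open>consistent_singletons_imp_list_colorable\<close>), so \<open>Yes\<close> is a safe answer. If consistency is lost on
  the way although the initial instance was consistent, then consistency does not characterize
  colorability, so no tree decomposition with bags of at most \<open>d\<close> vertices exists. The initial consistency also
  excludes cliques of size \<open>k + 1\<close>, since these would have to be colored within a single tuple. So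
  the clique number is at most \<open>k\<close>, and a graph in the class would have treewidth less than \<open>d\<close>:
  the answer \<open>Not_In_Class\<close> is right as well.

  The program itself is not written down. The functions on trees that are computable in polynomial
  time are shown to be closed under the operations needed (\<open>polytime\<close>), notably under bounded
  iteration over a list, and the algorithm is composed from these operations (\<open>solve\<close>).
\<close>

section \<open>Polynomial-time functions on trees\<close>

lemma poly_nat_mono: "x \<le> y \<Longrightarrow> poly p x \<le> poly p y" for p :: "nat poly"
  by (induction p) (auto intro: add_mono mult_mono)

text \<open>
  A program for \<open>F\<close> at register \<open>b\<close> finds its argument in register \<open>b\<close> and leaves the result there; it
  may overwrite all registers above \<open>b\<close>, with arbitrary initial contents, and preserves those below.
  With this convention programs can be nested without renaming variables or clearing registers.
\<close>

definition computes :: "com \<Rightarrow> nat \<Rightarrow> (sexp \<Rightarrow> sexp) \<Rightarrow> nat poly \<Rightarrow> bool" where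
  "computes c b F p \<longleftrightarrow> (\<forall>s. \<exists>t s'. exec c s t s' \<and> s' b = F (s b) \<and>
     (\<forall>y<b. s' y = s y) \<and> t \<le> poly p (size (s b)))"

text \<open>
  The size of the result needs a bound of its own: doubling a tree by \<open>CONS\<close> takes constant time, so
  short computations may build exponentially large trees.
\<close>

definition polytime :: "(sexp \<Rightarrow> sexp) \<Rightarrow> bool" where
  "polytime F \<longleftrightarrow> (\<exists>p. (\<forall>x. size (F x) \<le> poly p (size x)) \<and> (\<forall>b. \<exists>c. computes c b F p))"

lemma computesI:
  assumes "\<And>s. \<exists>t s'. exec c s t s' \<and> s' b = F (s b) \<and> (\<forall>y<b. s' y = s y) \<and> t \<le> poly p (size (s b))"
  shows "computes c b F p"
  using assms unfolding computes_def by (rule allI)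

lemma computesE:
  assumes "computes c b F p"
  obtains t s' where "exec c s t s'" "s' b = F (s b)" "\<And>y. y < b \<Longrightarrow> s' y = s y"
    "t \<le> poly p (size (s b))"
  using assms unfolding computes_def by blast

lemma polytimeI:
  assumes size: "\<And>x. size (F x) \<le> poly p (size x)" and comp: "\<And>b. \<exists>c. computes c b F q"
  shows "polytime F"
  unfolding polytime_def
proof (intro exI[of _ "p + q"] conjI allI)
  show "size (F x) \<le> poly (p + q) (size x)" for x
    using size[of x] by simp
  fix b
  obtain c where c: "computes c b F q" using comp by blast
  have "computes c b F (p + q)"
  proof (rule computesI)
    fix s
    obtain t s' where "exec c s t s'" "s' b = F (s b)" "\<And>y. y < b \<Longrightarrow> s' y = s y"
      "t \<le> poly q (size (s b))" by (rule computesE[OF c, where s="s"]) (rule that)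
    then show "\<exists>t s'. exec c s t s' \<and> s' b = F (s b) \<and> (\<forall>y<b. s' y = s y) \<and>
        t \<le> poly (p + q) (size (s b))"
      by (intro exI[of _ t] exI[of _ s']) auto
  qed
  then show "\<exists>c. computes c b F (p + q)" ..
qed

text \<open>
  A subroutine call: the value of \<open>e\<close> is moved to register \<open>b\<close> and replaced by its image under \<open>F\<close>.
\<close>

definition calls :: "com \<Rightarrow> nat \<Rightarrow> (sexp \<Rightarrow> sexp) \<Rightarrow> expr \<Rightarrow> nat poly \<Rightarrow> bool" where
  "calls c b F e p \<longleftrightarrow> (\<forall>s. \<exists>t s'. exec c s t s' \<and> s' b = F (eval_expr e s) \<and>
     (\<forall>y<b. s' y = s y) \<and> t \<le> poly p (size (eval_expr e s)) + expr_cost e + 1)"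

lemma callsE:
  assumes "calls c b F e p"
  obtains t s' where "exec c s t s'" "s' b = F (eval_expr e s)" "\<And>y. y < b \<Longrightarrow> s' y = s y"
    "t \<le> poly p (size (eval_expr e s)) + expr_cost e + 1"
  using assms unfolding calls_def by blast

lemma polytimeE:
  assumes "polytime F"
  obtains p where "\<And>x. size (F x) \<le> poly p (size x)" "\<And>b e. \<exists>c. calls c b F e p"
proof -
  obtain p where sz: "\<forall>x. size (F x) \<le> poly p (size x)" and comp: "\<forall>b. \<exists>c. computes c b F p"
    using assms unfolding polytime_def by blast
  have "\<exists>c. calls c b F e p" for b e
  proof -
    obtain c where c: "computes c b F p" using comp by blast
    have "\<exists>t s'. exec (Seq (Assign b e) c) s t s' \<and> s' b = F (eval_expr e s) \<and> (\<forall>y<b. s' y = s y) \<and>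
      t \<le> poly p (size (eval_expr e s)) + expr_cost e + 1" for s
    proof -
      let ?s = "s(b := eval_expr e s)"
      obtain t s' where 1: "exec c ?s t s'" "s' b = F (?s b)" "\<And>y. y < b \<Longrightarrow> s' y = ?s y"
        "t \<le> poly p (size (?s b))" by (rule computesE[OF c, where s="?s"]) (rule that)
      then show ?thesis
        using exec.Seq[OF exec.Assign 1(1)]
        by (intro exI[of _ "(1 + expr_cost e) + t"] exI[of _ s']) auto
    qed
    then have "calls (Seq (Assign b e) c) b F e p" unfolding calls_def by simp
    then show ?thesis ..
  qed
  with sz show ?thesis by (intro that[of p]) auto
qed

lemma polytime_expr:
  assumes "\<And>b. \<exists>e. expr_cost e \<le> m \<and> (\<forall>s. eval_expr e s = F (s b))"
    and "\<And>x. size (F x) \<le> size x + m"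
  shows "polytime F"
proof (rule polytimeI)
  show "size (F x) \<le> poly [:m, 1:] (size x)" for x using assms(2)[of x] by simp
  fix b
  obtain e where e: "expr_cost e \<le> m" "\<And>s. eval_expr e s = F (s b)" using assms(1)[of b] by blast
  have "computes (Assign b e) b F [:m + 1:]"
  proof (rule computesI)
    fix s
    show "\<exists>t s'. exec (Assign b e) s t s' \<and> s' b = F (s b) \<and> (\<forall>y<b. s' y = s y) \<and>
        t \<le> poly [:m + 1:] (size (s b))"
      using exec.Assign[of b e s] e
      by (intro exI[of _ "1 + expr_cost e"] exI[of _ "s(b := eval_expr e s)"]) auto
  qed
  then show "\<exists>c. computes c b F [:m + 1:]" ..
qed

lemma polytime_id: "polytime (\<lambda>x. x)"
  by (rule polytime_expr[of 1]) (auto intro: exI[of _ "EVar _"])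

fun const_expr :: "sexp \<Rightarrow> expr" where
  "const_expr NIL = ENil"
| "const_expr (CONS a b) = ECons (const_expr a) (const_expr b)"

lemma polytime_const: "polytime (\<lambda>_. k)"
proof (rule polytime_expr[of "expr_cost (const_expr k) + size k"])
  have "eval_expr (const_expr k) s = k" for s by (induction k) auto
  then show "\<exists>e. expr_cost e \<le> expr_cost (const_expr k) + size k \<and> (\<forall>s. eval_expr e s = k)"
    by (intro exI[of _ "const_expr k"]) auto
qed simp

lemma polytime_comp:
  assumes "polytime F" "polytime G"
  shows "polytime (\<lambda>x. F (G x))"
proof -
  obtain p where p: "\<And>x. size (F x) \<le> poly p (size x)" and cF: "\<And>b e. \<exists>c. calls c b F e p"
    by (rule polytimeE[OF assms(1)], rule that)
  obtain q where q: "\<And>x. size (G x) \<le> poly q (size x)" and cG: "\<And>b e. \<exists>c. calls c b G e q"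
    by (rule polytimeE[OF assms(2)], rule that)
  have pq: "poly p (size (G x)) \<le> poly (pcompose p q) (size x)" for x
    using poly_nat_mono[OF q] by (simp add: poly_pcompose)
  let ?r = "q + pcompose p q + [:4:]"
  show ?thesis
  proof (rule polytimeI)
    show "size (F (G x)) \<le> poly (pcompose p q) (size x)" for x
      using p[of "G x"] pq[of x] by linarith
    fix b
    obtain c1 where c1: "calls c1 b G (EVar b) q" using cG by blast
    obtain c2 where c2: "calls c2 b F (EVar b) p" using cF by blast
    have "computes (Seq c1 c2) b (\<lambda>x. F (G x)) ?r"
    proof (rule computesI)
      fix s
      obtain t s' where 1: "exec c1 s t s'" "s' b = G (eval_expr (EVar b) s)"
        "\<And>y. y < b \<Longrightarrow> s' y = s y" "t \<le> poly q (size (eval_expr (EVar b) s)) + expr_cost (EVar b) + 1"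
        by (rule callsE[OF c1, where s="s"]) (rule that)
      obtain u s'' where 2: "exec c2 s' u s''" "s'' b = F (eval_expr (EVar b) s')"
        "\<And>y. y < b \<Longrightarrow> s'' y = s' y" "u \<le> poly p (size (eval_expr (EVar b) s')) + expr_cost (EVar b) + 1"
        by (rule callsE[OF c2, where s="s'"]) (rule that)
      show "\<exists>t s'. exec (Seq c1 c2) s t s' \<and> s' b = F (G (s b)) \<and> (\<forall>y<b. s' y = s y) \<and>
          t \<le> poly ?r (size (s b))"
        using exec.Seq[OF 1(1) 2(1)] 1 2 pq[of "s b"]
        by (intro exI[of _ "t + u"] exI[of _ s'']) auto
    qed
    then show "\<exists>c. computes c b (\<lambda>x. F (G x)) ?r" ..
  qed
qed

lemma polytime_hd: "polytime F \<Longrightarrow> polytime (\<lambda>x. hd_sexp (F x))"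
proof (rule polytime_comp[of hd_sexp], rule polytime_expr[of 2])
  show "\<exists>e. expr_cost e \<le> 2 \<and> (\<forall>s. eval_expr e s = hd_sexp (s b))" for b
    by (intro exI[of _ "EHd (EVar b)"]) auto
  show "size (hd_sexp x) \<le> size x + 2" for x by (cases x) auto
qed

lemma polytime_tl: "polytime F \<Longrightarrow> polytime (\<lambda>x. tl_sexp (F x))"
proof (rule polytime_comp[of tl_sexp], rule polytime_expr[of 2])
  show "\<exists>e. expr_cost e \<le> 2 \<and> (\<forall>s. eval_expr e s = tl_sexp (s b))" for b
    by (intro exI[of _ "ETl (EVar b)"]) auto
  show "size (tl_sexp x) \<le> size x + 2" for x by (cases x) auto
qed

lemma polytime_cons:
  assumes "polytime F" "polytime G"
  shows "polytime (\<lambda>x. CONS (F x) (G x))"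
proof -
  obtain p where p: "\<And>x. size (F x) \<le> poly p (size x)" and cF: "\<And>b e. \<exists>c. calls c b F e p"
    by (rule polytimeE[OF assms(1)], rule that)
  obtain q where q: "\<And>x. size (G x) \<le> poly q (size x)" and cG: "\<And>b e. \<exists>c. calls c b G e q"
    by (rule polytimeE[OF assms(2)], rule that)
  show ?thesis
  proof (rule polytimeI)
    show "size (CONS (F x) (G x)) \<le> poly (p + q + [:1:]) (size x)" for x
      using p[of x] q[of x] by simp
    fix b
    obtain c1 where c1: "calls c1 (b+1) F (EVar b) p" using cF by blast
    obtain c2 where c2: "calls c2 (b+2) G (EVar b) q" using cG by blast
    let ?e = "ECons (EVar (b+1)) (EVar (b+2))"
    let ?c = "Seq (Seq c1 c2) (Assign b ?e)"
    have "computes ?c b (\<lambda>x. CONS (F x) (G x)) (p + q + [:8:])"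
    proof (rule computesI)
      fix s
      obtain t s' where 1: "exec c1 s t s'" "s' (b+1) = F (eval_expr (EVar b) s)"
        "\<And>y. y < b+1 \<Longrightarrow> s' y = s y" "t \<le> poly p (size (eval_expr (EVar b) s)) + expr_cost (EVar b) + 1"
        by (rule callsE[OF c1, where s="s"]) (rule that)
      obtain u s'' where 2: "exec c2 s' u s''" "s'' (b+2) = G (eval_expr (EVar b) s')"
        "\<And>y. y < b+2 \<Longrightarrow> s'' y = s' y" "u \<le> poly q (size (eval_expr (EVar b) s')) + expr_cost (EVar b) + 1"
        by (rule callsE[OF c2, where s="s'"]) (rule that)
      show "\<exists>t s'. exec ?c s t s' \<and> s' b = CONS (F (s b)) (G (s b)) \<and> (\<forall>y<b. s' y = s y) \<and>
          t \<le> poly (p + q + [:8:]) (size (s b))"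
        using exec.Seq[OF exec.Seq[OF 1(1) 2(1)] exec.Assign[of b ?e]] 1(2-4) 2(2-4)
        by (intro exI[of _ "t + u + (1 + expr_cost ?e)"] exI[of _ "s''(b := eval_expr ?e s'')"]) auto
    qed
    then show "\<exists>c. computes c b (\<lambda>x. CONS (F x) (G x)) (p + q + [:8:])" ..
  qed
qed

lemma polytime_cond:
  assumes "polytime T" "polytime F" "polytime G"
  shows "polytime (\<lambda>x. if T x \<noteq> NIL then F x else G x)"
proof -
  obtain r where cT: "\<And>b e. \<exists>c. calls c b T e r"
    using polytimeE[OF assms(1)] by metis
  obtain p where p: "\<And>x. size (F x) \<le> poly p (size x)" and cF: "\<And>b e. \<exists>c. calls c b F e p"
    by (rule polytimeE[OF assms(2)], rule that)
  obtain q where q: "\<And>x. size (G x) \<le> poly q (size x)" and cG: "\<And>b e. \<exists>c. calls c b G e q"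
    by (rule polytimeE[OF assms(3)], rule that)
  let ?r = "r + p + q + [:6:]"
  show ?thesis
  proof (rule polytimeI)
    show "size (if T x \<noteq> NIL then F x else G x) \<le> poly (p + q) (size x)" for x
      using p[of x] q[of x] by simp
    fix b
    obtain c0 where c0: "calls c0 (b+1) T (EVar b) r" using cT by blast
    obtain c1 where c1: "calls c1 b F (EVar b) p" using cF by blast
    obtain c2 where c2: "calls c2 b G (EVar b) q" using cG by blast
    let ?c = "Seq c0 (If (EVar (b+1)) c1 c2)"
    have "computes ?c b (\<lambda>x. if T x \<noteq> NIL then F x else G x) ?r"
    proof (rule computesI)
      fix s
      obtain t s' where 1: "exec c0 s t s'" "s' (b+1) = T (eval_expr (EVar b) s)"
        "\<And>y. y < b+1 \<Longrightarrow> s' y = s y" "t \<le> poly r (size (eval_expr (EVar b) s)) + expr_cost (EVar b) + 1"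
        by (rule callsE[OF c0, where s="s"]) (rule that)
      show "\<exists>t s'. exec ?c s t s' \<and> s' b = (if T (s b) \<noteq> NIL then F (s b) else G (s b)) \<and>
          (\<forall>y<b. s' y = s y) \<and> t \<le> poly ?r (size (s b))"
      proof (cases "T (s b) \<noteq> NIL")
        case True
        obtain u s'' where 2: "exec c1 s' u s''" "s'' b = F (eval_expr (EVar b) s')"
          "\<And>y. y < b \<Longrightarrow> s'' y = s' y" "u \<le> poly p (size (eval_expr (EVar b) s')) + expr_cost (EVar b) + 1"
          by (rule callsE[OF c1, where s="s'"]) (rule that)
        have "exec (If (EVar (b+1)) c1 c2) s' (1 + expr_cost (EVar (b+1)) + u) s''"
          using True 1 2 by (intro exec.IfTrue) auto
        from exec.Seq[OF 1(1) this] show ?thesis using True 1(2-4) 2(2-4)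
          by (intro exI[of _ "t + (1 + expr_cost (EVar (b+1)) + u)"] exI[of _ s'']) auto
      next
        case False
        obtain u s'' where 2: "exec c2 s' u s''" "s'' b = G (eval_expr (EVar b) s')"
          "\<And>y. y < b \<Longrightarrow> s'' y = s' y" "u \<le> poly q (size (eval_expr (EVar b) s')) + expr_cost (EVar b) + 1"
          by (rule callsE[OF c2, where s="s'"]) (rule that)
        have "exec (If (EVar (b+1)) c1 c2) s' (1 + expr_cost (EVar (b+1)) + u) s''"
          using False 1 2 by (intro exec.IfFalse) auto
        from exec.Seq[OF 1(1) this] show ?thesis using False 1(2-4) 2(2-4)
          by (intro exI[of _ "t + (1 + expr_cost (EVar (b+1)) + u)"] exI[of _ s'']) auto
      qed
    qed
    then show "\<exists>c. computes c b (\<lambda>x. if T x \<noteq> NIL then F x else G x) ?r" ..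
  qed
qed

lemma polytime_if:
  assumes "polytime (\<lambda>x. enc_bool (P x))" "polytime F" "polytime G"
  shows "polytime (\<lambda>x. if P x then F x else G x)"
proof -
  have "enc_bool (P x) \<noteq> NIL \<longleftrightarrow> P x" for x by (cases "P x") auto
  then show ?thesis using polytime_cond[OF assms] by simp
qed

section \<open>Trees as lists\<close>

text \<open>
  Reading the right spine of a tree as a list is a bijection, inverse to \<open>enc_list\<close>, so every tree is
  at the same time a list of trees. All data structures below are such lists.
\<close>

fun dec_list :: "sexp \<Rightarrow> sexp list" where
  "dec_list NIL = []"
| "dec_list (CONS a b) = a # dec_list b"

lemma dec_enc_list [simp]: "dec_list (enc_list xs) = xs"
  by (induction xs) auto

lemma enc_dec_list [simp]: "enc_list (dec_list x) = x"
  by (induction x) auto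

lemma size_enc_list: "size (enc_list xs) = (\<Sum>y\<leftarrow>xs. Suc (size y))"
  by (induction xs) auto

lemma size_dec_list: "size x = (\<Sum>y\<leftarrow>dec_list x. Suc (size y))"
  using size_enc_list[of "dec_list x"] by simp

lemma length_dec_list_le: "length (dec_list x) \<le> size x"
  by (induction x) auto

lemma size_mem_dec_list: "y \<in> set (dec_list x) \<Longrightarrow> size y < size x"
  by (induction x) auto

text \<open>
  The only source of iteration. The hypothesis on the sizes of the intermediate results excludes steps
  that double the accumulator and would blow it up exponentially. The step function receives the
  accumulator, the list element and the argument \<open>x\<close> as nested pairs.

  Registers: \<open>b\<close> holds \<open>x\<close>, \<open>b + 1\<close> the remaining list, \<open>b + 2\<close> the accumulator, and the step function
  is called at \<open>b + 3\<close>.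
\<close>

lemma polytime_foldl_bounded:
  assumes L: "polytime L" and A: "polytime A"
    and F: "polytime (\<lambda>z. F (hd_sexp z) (hd_sexp (tl_sexp z)) (tl_sexp (tl_sexp z)))"
    and bound: "\<And>x ys zs. dec_list (L x) = ys @ zs \<Longrightarrow>
      size (foldl (\<lambda>a y. F a y x) (A x) ys) \<le> poly q (size x)"
  shows "polytime (\<lambda>x. foldl (\<lambda>a y. F a y x) (A x) (dec_list (L x)))"
proof -
  let ?F = "\<lambda>z. F (hd_sexp z) (hd_sexp (tl_sexp z)) (tl_sexp (tl_sexp z))"
  obtain pL where pL: "\<And>x. size (L x) \<le> poly pL (size x)" and cL: "\<And>b e. \<exists>c. calls c b L e pL"
    by (rule polytimeE[OF L], rule that)
  obtain pA where cA: "\<And>b e. \<exists>c. calls c b A e pA"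
    using polytimeE[OF A] by metis
  obtain pF where cF: "\<And>b e. \<exists>c. calls c b ?F e pF"
    using polytimeE[OF F] by metis
  \<comment> \<open>The argument of the step function consists of an accumulator, a list element, \<open>x\<close> and two pairs.\<close>
  define M where "M = pcompose pF (q + pL + [:2, 1:])"
  have M: "poly pF (size acc + size y + size x + 2) \<le> poly M (size x)"
    if "size acc \<le> poly q (size x)" "size y \<le> size (L x)" for acc y x :: sexp
    unfolding M_def poly_pcompose using that pL[of x] by (intro poly_nat_mono) simp
  let ?r = "pL + pA + pL * (M + [:14:]) + [:8:]"
  show ?thesis
  proof (rule polytimeI)
    show "size (foldl (\<lambda>a y. F a y x) (A x) (dec_list (L x))) \<le> poly q (size x)" for x
      using bound[of x "dec_list (L x)" "[]"] by simp
    fix b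
    obtain cl where cl: "calls cl (b+1) L (EVar b) pL" using cL by blast
    obtain ca where ca: "calls ca (b+2) A (EVar b) pA" using cA by blast
    let ?e = "ECons (EVar (b+2)) (ECons (EHd (EVar (b+1))) (EVar b))"
    obtain cf where cf: "calls cf (b+3) ?F ?e pF" using cF by blast
    let ?body = "Seq (Seq cf (Assign (b+2) (EVar (b+3)))) (Assign (b+1) (ETl (EVar (b+1))))"
    let ?loop = "While (EVar (b+1)) ?body"
    have loop: "\<exists>t s'. exec ?loop s t s' \<and> s' b = s b \<and>
        s' (b+2) = foldl (\<lambda>a y. F a y x) (A x) (dec_list (L x)) \<and> (\<forall>y<b. s' y = s y) \<and>
        t \<le> length zs * (poly M (size x) + 14) + 2"
      if "dec_list (L x) = ys @ zs" "s b = x" "s (b+1) = enc_list zs"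
        "s (b+2) = foldl (\<lambda>a y. F a y x) (A x) ys" for s x ys zs
      using that
    proof (induction zs arbitrary: ys s)
      case Nil
      then have "exec ?loop s (1 + expr_cost (EVar (b+1))) s" by (intro exec.WhileFalse) auto
      with Nil show ?case by (intro exI[of _ "1 + expr_cost (EVar (b+1))"] exI[of _ s]) auto
    next
      case (Cons z zs)
      obtain t1 s1 where 1: "exec cf s t1 s1" "s1 (b+3) = ?F (eval_expr ?e s)"
        "\<And>y. y < b+3 \<Longrightarrow> s1 y = s y" "t1 \<le> poly pF (size (eval_expr ?e s)) + expr_cost ?e + 1"
        by (rule callsE[OF cf, where s="s"]) (rule that)
      have e: "eval_expr ?e s = CONS (s (b+2)) (CONS z x)" using Cons.prems by simp
      have "z \<in> set (dec_list (L x))" using Cons.prems by simp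
      then have t1: "t1 \<le> poly M (size x) + 7"
        using M[of "s (b+2)" x z] bound[OF Cons.prems(1)] size_mem_dec_list[of z "L x"] 1(4) Cons.prems(4)
        unfolding e by (simp add: ac_simps)
      define s2 where "s2 = s1(b+2 := s1 (b+3))"
      define s3 where "s3 = s2(b+1 := tl_sexp (s2 (b+1)))"
      have 2: "exec (Assign (b+2) (EVar (b+3))) s1 2 s2"
        using exec.Assign[of "b+2" "EVar (b+3)" s1] by (simp add: s2_def eval_nat_numeral)
      have 3: "exec (Assign (b+1) (ETl (EVar (b+1)))) s2 3 s3"
        using exec.Assign[of "b+1" "ETl (EVar (b+1))" s2] by (simp add: s3_def eval_nat_numeral)
      have body: "exec ?body s (t1 + 2 + 3) s3"
        by (rule exec.Seq[OF exec.Seq[OF 1(1) 2] 3])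
      have s3: "s3 b = x" "\<And>y. y < b \<Longrightarrow> s3 y = s y" "s3 (b+1) = enc_list zs"
        "s3 (b+2) = foldl (\<lambda>a y. F a y x) (A x) (ys @ [z])"
        using 1(2,3) Cons.prems unfolding e by (auto simp: s3_def s2_def)
      obtain t s' where 4: "exec ?loop s3 t s'" "s' b = s3 b"
        "s' (b+2) = foldl (\<lambda>a y. F a y x) (A x) (dec_list (L x))" "\<forall>y<b. s' y = s3 y"
        "t \<le> length zs * (poly M (size x) + 14) + 2"
        using Cons.IH[OF _ s3(1,3,4)] Cons.prems(1) by auto
      have "exec ?loop s (1 + expr_cost (EVar (b+1)) + (t1 + 2 + 3) + t) s'"
        using Cons.prems by (intro exec.WhileTrue[OF _ body 4(1)]) auto
      with 4(2-5) s3(1,2) t1 Cons.prems(2) show ?case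
        by (intro exI[of _ "1 + expr_cost (EVar (b+1)) + (t1 + 2 + 3) + t"] exI[of _ s']) auto
    qed
    let ?c = "Seq (Seq (Seq cl ca) ?loop) (Assign b (EVar (b+2)))"
    have "computes ?c b (\<lambda>x. foldl (\<lambda>a y. F a y x) (A x) (dec_list (L x))) ?r"
    proof (rule computesI)
      fix s
      obtain t1 s1 where 1: "exec cl s t1 s1" "s1 (b+1) = L (eval_expr (EVar b) s)"
        "\<And>y. y < b+1 \<Longrightarrow> s1 y = s y" "t1 \<le> poly pL (size (eval_expr (EVar b) s)) + expr_cost (EVar b) + 1"
        by (rule callsE[OF cl, where s="s"]) (rule that)
      obtain t2 s2 where 2: "exec ca s1 t2 s2" "s2 (b+2) = A (eval_expr (EVar b) s1)"
        "\<And>y. y < b+2 \<Longrightarrow> s2 y = s1 y" "t2 \<le> poly pA (size (eval_expr (EVar b) s1)) + expr_cost (EVar b) + 1"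
        by (rule callsE[OF ca, where s="s1"]) (rule that)
      obtain t3 s3 where 3: "exec ?loop s2 t3 s3" "s3 b = s2 b"
        "s3 (b+2) = foldl (\<lambda>a y. F a y (s b)) (A (s b)) (dec_list (L (s b)))" "\<forall>y<b. s3 y = s2 y"
        "t3 \<le> length (dec_list (L (s b))) * (poly M (size (s b)) + 14) + 2"
        using loop[of "s b" "[]" "dec_list (L (s b))" s2] 1 2 by auto
      have "length (dec_list (L (s b))) * (poly M (size (s b)) + 14) \<le>
          poly pL (size (s b)) * (poly M (size (s b)) + 14)"
        using length_dec_list_le[of "L (s b)"] pL[of "s b"] by (intro mult_right_mono) auto
      then have t3: "t3 \<le> poly pL (size (s b)) * (poly M (size (s b)) + 14) + 2"
        using 3(5) by linarith
      with exec.Seq[OF exec.Seq[OF exec.Seq[OF 1(1) 2(1)] 3(1)] exec.Assign[of b "EVar (b+2)"]]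
        1(2-4) 2(2-4) 3(2-4)
      show "\<exists>t s'. exec ?c s t s' \<and>
          s' b = foldl (\<lambda>a y. F a y (s b)) (A (s b)) (dec_list (L (s b))) \<and>
          (\<forall>y<b. s' y = s y) \<and> t \<le> poly ?r (size (s b))"
        by (intro exI[of _ "t1 + t2 + t3 + (1 + expr_cost (EVar (b+2)))"]
              exI[of _ "s3(b := eval_expr (EVar (b+2)) s3)"]) auto
    qed
    then show "\<exists>c. computes c b (\<lambda>x. foldl (\<lambda>a y. F a y x) (A x) (dec_list (L x))) ?r" ..
  qed
qed

lemma polytime_nonempty:
  assumes "polytime T"
  shows "polytime (\<lambda>x. enc_bool (T x \<noteq> NIL))"
proof -
  have "polytime (\<lambda>x. if T x \<noteq> NIL then enc_bool True else enc_bool False)"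
    by (rule polytime_cond[OF assms polytime_const polytime_const])
  moreover have "(if T x \<noteq> NIL then enc_bool True else enc_bool False) = enc_bool (T x \<noteq> NIL)" for x
    by simp
  ultimately show ?thesis by simp
qed

lemma polytime_not:
  assumes "polytime (\<lambda>x. enc_bool (P x))"
  shows "polytime (\<lambda>x. enc_bool (\<not> P x))"
proof -
  have "polytime (\<lambda>x. if P x then enc_bool False else enc_bool True)"
    by (rule polytime_if[OF assms polytime_const polytime_const])
  moreover have "(if P x then enc_bool False else enc_bool True) = enc_bool (\<not> P x)" for x
    by simp
  ultimately show ?thesis by (simp only:)
qed

lemma polytime_imp:
  assumes "polytime (\<lambda>x. enc_bool (P x))" "polytime (\<lambda>x. enc_bool (Q x))"
  shows "polytime (\<lambda>x. enc_bool (P x \<longrightarrow> Q x))"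
proof -
  have "polytime (\<lambda>x. if P x then enc_bool (Q x) else enc_bool True)"
    by (rule polytime_if[OF assms polytime_const])
  moreover have "(if P x then enc_bool (Q x) else enc_bool True) = enc_bool (P x \<longrightarrow> Q x)" for x
    by simp
  ultimately show ?thesis by (simp only:)
qed

lemma polytime_conj:
  assumes "polytime (\<lambda>x. enc_bool (P x))" "polytime (\<lambda>x. enc_bool (Q x))"
  shows "polytime (\<lambda>x. enc_bool (P x \<and> Q x))"
proof -
  have "polytime (\<lambda>x. if P x then enc_bool (Q x) else enc_bool False)"
    by (rule polytime_if[OF assms polytime_const])
  moreover have "(if P x then enc_bool (Q x) else enc_bool False) = enc_bool (P x \<and> Q x)" for x
    by simp
  ultimately show ?thesis by (simp only:)
qed

lemma polytime_all_less:
  fixes d :: nat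
  assumes "\<And>j. j < d \<Longrightarrow> polytime (\<lambda>x. enc_bool (P j x))"
  shows "polytime (\<lambda>x. enc_bool (\<forall>j<d. P j x))"
  using assms
proof (induction d)
  case 0
  then show ?case by (simp only: not_less0 simp_thms) (rule polytime_const)
next
  case (Suc d)
  then have "polytime (\<lambda>x. enc_bool (P d x \<and> (\<forall>j<d. P j x)))"
    by (intro polytime_conj) simp_all
  then show ?case by (simp only: All_less_Suc)
qed

text \<open>
  A step that enlarges the accumulator only by an amount polynomial in the other data, independently
  of the accumulator, keeps the whole iteration polynomial.
\<close>

lemma polytime_foldl:
  assumes L: "polytime L" and A: "polytime A"
    and F: "polytime (\<lambda>z. F (hd_sexp z) (hd_sexp (tl_sexp z)) (tl_sexp (tl_sexp z)))"
    and growth: "\<And>a y x. size (F a y x) \<le> size a + poly r (size y + size x)"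
  shows "polytime (\<lambda>x. foldl (\<lambda>a y. F a y x) (A x) (dec_list (L x)))"
proof -
  obtain pL where pL: "\<And>x. size (L x) \<le> poly pL (size x)"
    using polytimeE[OF L] by metis
  obtain pA where pA: "\<And>x. size (A x) \<le> poly pA (size x)"
    using polytimeE[OF A] by metis
  let ?R = "pcompose r (pL + [:0, 1:])"
  have "size (foldl (\<lambda>a y. F a y x) (A x) ys) \<le> size (A x) + length ys * poly ?R (size x)"
    if "set ys \<subseteq> set (dec_list (L x))" for x ys
    using that
  proof (induction ys rule: rev_induct)
    case (snoc y ys)
    have "size y + size x \<le> poly (pL + [:0, 1:]) (size x)"
      using snoc.prems size_mem_dec_list[of y "L x"] pL[of x] by simp
    then have "poly r (size y + size x) \<le> poly ?R (size x)"
      by (simp add: poly_pcompose poly_nat_mono)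
    then show ?case using snoc growth[of "foldl (\<lambda>a y. F a y x) (A x) ys" y x] by simp
  qed simp
  note bound = this
  show ?thesis
  proof (rule polytime_foldl_bounded[where q = "pA + pL * ?R", OF L A F])
    fix x ys zs
    assume yz: "dec_list (L x) = ys @ zs"
    have "length ys \<le> poly pL (size x)"
      using length_dec_list_le[of "L x"] pL[of x] unfolding yz by simp
    then have "length ys * poly ?R (size x) \<le> poly pL (size x) * poly ?R (size x)"
      by (rule mult_right_mono) simp
    moreover have "size (foldl (\<lambda>a y. F a y x) (A x) ys) \<le> size (A x) + length ys * poly ?R (size x)"
      using yz by (intro bound) simp
    ultimately show "size (foldl (\<lambda>a y. F a y x) (A x) ys) \<le> poly (pA + pL * ?R) (size x)"
      unfolding poly_add poly_mult using pA[of x] by linarith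
  qed
qed

text \<open>
  Functions of two arguments are handled as functions of a pair. This form turns a statement about
  the components of a pair into one that can be used for backward reasoning with arbitrary arguments.
\<close>

lemma polytime_env:
  assumes "polytime (\<lambda>z. F (hd_sexp z) (tl_sexp z))" "polytime A" "polytime B"
  shows "polytime (\<lambda>x. F (A x) (B x))"
  using polytime_comp[OF assms(1) polytime_cons[OF assms(2,3)]] by simp

text \<open>
  Only lists that stand for sets are built in this way, so the reversal does no harm.
\<close>

definition rev_append :: "sexp \<Rightarrow> sexp \<Rightarrow> sexp" where
  "rev_append u a = foldl (\<lambda>a y. CONS y a) a (dec_list u)"

lemma foldl_CONS: "foldl (\<lambda>a y. CONS y a) a ys = enc_list (rev ys @ dec_list a)"
  by (induction ys arbitrary: a) auto

lemma dec_list_rev_append [simp]: "dec_list (rev_append u a) = rev (dec_list u) @ dec_list a"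
  by (simp add: rev_append_def foldl_CONS)

lemma size_rev_append: "size (rev_append u a) = size u + size a"
  using size_dec_list[of "rev_append u a"] size_dec_list[of u] size_dec_list[of a]
  by (simp add: rev_map[symmetric])

lemma polytime_rev_append:
  assumes "polytime U" "polytime A"
  shows "polytime (\<lambda>x. rev_append (U x) (A x))"
  unfolding rev_append_def
proof (rule polytime_foldl[where r = "[:1, 1:]", OF assms])
  show "size (CONS y a) \<le> size a + poly [:1, 1:] (size y + size x)" for a y x :: sexp by simp
qed (intro polytime_cons polytime_hd polytime_tl polytime_id)

text \<open>
  Together with \<open>if\<close>, this operation yields comprehensions, filters and bounded quantifiers.
\<close>

definition concat_map :: "(sexp \<Rightarrow> sexp) \<Rightarrow> sexp \<Rightarrow> sexp" where
  "concat_map f l = foldl (\<lambda>a y. rev_append (f y) a) NIL (dec_list l)"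

lemma set_concat_map:
  "set (dec_list (concat_map f l)) = (\<Union>y\<in>set (dec_list l). set (dec_list (f y)))"
proof -
  have "set (dec_list (foldl (\<lambda>a y. rev_append (f y) a) a ys)) =
      set (dec_list a) \<union> (\<Union>y\<in>set ys. set (dec_list (f y)))" for a ys
    by (induction ys arbitrary: a) auto
  then show ?thesis by (simp add: concat_map_def)
qed

lemma size_concat_map: "size (concat_map f l) = (\<Sum>y\<leftarrow>dec_list l. size (f y))"
proof -
  have "size (foldl (\<lambda>a y. rev_append (f y) a) a ys) = size a + (\<Sum>y\<leftarrow>ys. size (f y))" for a ys
    by (induction ys arbitrary: a) (auto simp: size_rev_append)
  then show ?thesis by (simp add: concat_map_def)
qed

lemma polytime_concat_map:
  assumes f: "polytime (\<lambda>z. f (hd_sexp z) (tl_sexp z))" and L: "polytime L"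
  shows "polytime (\<lambda>x. concat_map (\<lambda>y. f y x) (L x))"
proof -
  obtain p where p: "\<And>z. size (f (hd_sexp z) (tl_sexp z)) \<le> poly p (size z)"
    using polytimeE[OF f] by metis
  have growth: "size (rev_append (f y x) a) \<le> size a + poly (pcompose p [:1, 1:]) (size y + size x)"
    for a y x
    using p[of "CONS y x"] by (simp add: size_rev_append poly_pcompose)
  show ?thesis unfolding concat_map_def
    by (rule polytime_foldl[OF L polytime_const _ growth])
      (intro polytime_rev_append polytime_hd polytime_id polytime_comp[OF f polytime_tl])
qed

definition filter_tree :: "(sexp \<Rightarrow> bool) \<Rightarrow> sexp \<Rightarrow> sexp" where
  "filter_tree P l = concat_map (\<lambda>y. if P y then CONS y NIL else NIL) l"

lemma set_filter_tree [simp]: "set (dec_list (filter_tree P l)) = {y \<in> set (dec_list l). P y}"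
  by (auto simp: filter_tree_def set_concat_map split: if_splits)

lemma dec_list_eq_Nil_iff [simp]: "dec_list x = [] \<longleftrightarrow> x = NIL"
  by (cases x) auto

lemma size_filter_tree: "size (filter_tree P l) \<le> size l"
proof -
  have "size (filter_tree P l) = (\<Sum>y\<leftarrow>dec_list l. size (if P y then CONS y NIL else NIL))"
    by (simp add: filter_tree_def size_concat_map)
  also have "\<dots> \<le> (\<Sum>y\<leftarrow>dec_list l. Suc (size y))" by (rule sum_list_mono) simp
  finally show ?thesis by (simp add: size_dec_list[symmetric])
qed

lemma polytime_filter_tree:
  assumes "polytime (\<lambda>z. enc_bool (P (hd_sexp z) (tl_sexp z)))" and "polytime L"
  shows "polytime (\<lambda>x. filter_tree (\<lambda>y. P y x) (L x))"
  unfolding filter_tree_def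
  by (intro polytime_concat_map polytime_if polytime_cons polytime_hd polytime_id polytime_const assms)

lemma polytime_Bex:
  assumes "polytime (\<lambda>z. enc_bool (P (hd_sexp z) (tl_sexp z)))" and "polytime L"
  shows "polytime (\<lambda>x. enc_bool (\<exists>y\<in>set (dec_list (L x)). P y x))"
proof -
  have "(\<exists>y\<in>set (dec_list (L x)). P y x) \<longleftrightarrow> filter_tree (\<lambda>y. P y x) (L x) \<noteq> NIL" for x
  proof -
    have "filter_tree (\<lambda>y. P y x) (L x) \<noteq> NIL \<longleftrightarrow> set (dec_list (filter_tree (\<lambda>y. P y x) (L x))) \<noteq> {}"
      by (simp del: set_filter_tree)
    then show ?thesis unfolding set_filter_tree by blast
  qed
  then show ?thesis by (simp only:) (rule polytime_nonempty[OF polytime_filter_tree[OF assms]])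
qed

lemma polytime_Ball:
  assumes "polytime (\<lambda>z. enc_bool (P (hd_sexp z) (tl_sexp z)))" and "polytime L"
  shows "polytime (\<lambda>x. enc_bool (\<forall>y\<in>set (dec_list (L x)). P y x))"
proof -
  have "(\<forall>y\<in>set (dec_list (L x)). P y x) \<longleftrightarrow> \<not> (\<exists>y\<in>set (dec_list (L x)). \<not> P y x)" for x
    by blast
  then show ?thesis by (simp only:) (rule polytime_not[OF polytime_Bex[OF polytime_not[OF assms(1)] assms(2)]])
qed

definition len_tree :: "sexp \<Rightarrow> nat" where
  "len_tree x = length (dec_list x)"

lemma len_tree_enc_nat [simp]: "len_tree (enc_nat n) = n"
  by (simp add: len_tree_def enc_nat_def)

definition drop_tree :: "sexp \<Rightarrow> sexp \<Rightarrow> sexp" where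
  "drop_tree n l = foldl (\<lambda>a _. tl_sexp a) l (dec_list n)"

lemma dec_list_tl [simp]: "dec_list (tl_sexp x) = tl (dec_list x)"
  by (cases x) auto

lemma dec_list_drop_tree: "dec_list (drop_tree n l) = drop (len_tree n) (dec_list l)"
proof -
  have "dec_list (foldl (\<lambda>a _. tl_sexp a) l ys) = drop (length ys) (dec_list l)" for ys :: "sexp list"
    by (induction ys arbitrary: l) (simp_all add: drop_Suc)
  then show ?thesis by (simp add: drop_tree_def len_tree_def)
qed

lemma polytime_drop_tree:
  assumes "polytime N" "polytime L"
  shows "polytime (\<lambda>x. drop_tree (N x) (L x))"
  unfolding drop_tree_def
proof (rule polytime_foldl[where r = 0])
  show "size (tl_sexp a) \<le> size a + poly 0 (size y + size x)" for a y x :: sexp by (cases a) auto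
qed (intro assms polytime_hd polytime_tl polytime_id)+

definition nth_tree :: "sexp \<Rightarrow> sexp \<Rightarrow> sexp" where
  "nth_tree l n = hd_sexp (drop_tree n l)"

lemma nth_tree_enc_list: "len_tree n < length xs \<Longrightarrow> nth_tree (enc_list xs) n = xs ! len_tree n"
proof -
  assume "len_tree n < length xs"
  then have "dec_list (drop_tree n (enc_list xs)) = xs ! len_tree n # drop (Suc (len_tree n)) xs"
    by (simp add: dec_list_drop_tree Cons_nth_drop_Suc)
  then show ?thesis unfolding nth_tree_def by (cases "drop_tree n (enc_list xs)") auto
qed

lemma polytime_nth_tree: "polytime N \<Longrightarrow> polytime L \<Longrightarrow> polytime (\<lambda>x. nth_tree (L x) (N x))"
  unfolding nth_tree_def by (intro polytime_hd polytime_drop_tree)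

text \<open>
  Trees cannot be compared in one step, but vertices and colors are encoded in unary, so comparing
  lengths suffices. Two lists have the same length iff neither is longer than the other.
\<close>

lemma polytime_len_tree_eq:
  assumes "polytime F" "polytime G"
  shows "polytime (\<lambda>x. enc_bool (len_tree (F x) = len_tree (G x)))"
proof -
  have "len_tree (F x) = len_tree (G x) \<longleftrightarrow> \<not> drop_tree (F x) (G x) \<noteq> NIL \<and> \<not> drop_tree (G x) (F x) \<noteq> NIL" for x
    using dec_list_eq_Nil_iff[of "drop_tree (F x) (G x)"] dec_list_eq_Nil_iff[of "drop_tree (G x) (F x)"]
    by (auto simp: dec_list_drop_tree len_tree_def[of "F x"] len_tree_def[of "G x"])
  then show ?thesis by (simp only:)
    (intro polytime_conj polytime_not polytime_nonempty polytime_drop_tree assms)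
qed

text \<open>
  The unary numerals below the length of \<open>l\<close>. Each step of the iteration prepends the successor of
  the head, starting from the list with the single entry 0; this makes one numeral too many, the first.
\<close>

definition indices :: "sexp \<Rightarrow> sexp" where
  "indices l = tl_sexp (foldl (\<lambda>a _. CONS (CONS NIL (hd_sexp a)) a) (CONS NIL NIL) (dec_list l))"

lemma enc_nat_Suc: "enc_nat (Suc n) = CONS NIL (enc_nat n)"
  by (simp add: enc_nat_def)

lemma foldl_indices:
  "foldl (\<lambda>a _. CONS (CONS NIL (hd_sexp a)) a) (CONS NIL NIL) ys =
    enc_list (map enc_nat (rev [0..<Suc (length ys)]))"
  by (induction ys rule: rev_induct) (simp_all add: enc_nat_Suc, simp add: enc_nat_def)

lemma set_indices: "set (dec_list (indices l)) = enc_nat ` {..<len_tree l}"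
  unfolding indices_def foldl_indices by (auto simp: len_tree_def)

lemma size_enc_nat [simp]: "size (enc_nat n) = n"
  by (induction n) (auto simp: enc_nat_def)

lemma polytime_indices:
  assumes L: "polytime L"
  shows "polytime (\<lambda>x. indices (L x))"
proof -
  obtain pL where pL: "\<And>x. size (L x) \<le> poly pL (size x)"
    using polytimeE[OF L] by metis
  \<comment> \<open>The numeral \<open>i\<close> has size \<open>i\<close>, plus one cell for each entry of the list.\<close>
  have size: "size (enc_list (map enc_nat (rev [0..<n]))) \<le> n * n" for n
    by (induction n) (auto)
  show ?thesis unfolding indices_def
  proof (rule polytime_tl, rule polytime_foldl_bounded[where q = "(pL + 1) * (pL + 1)", OF L polytime_const])
    fix x ys zs
    assume "dec_list (L x) = ys @ zs"
    then have "length ys \<le> size (L x)"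
      using length_dec_list_le[of "L x"] by simp
    then have "length ys \<le> poly pL (size x)" using pL[of x] by (rule le_trans)
    then have le: "Suc (length ys) \<le> poly (pL + 1) (size x)" by simp
    have "Suc (length ys) * Suc (length ys) \<le> poly ((pL + 1) * (pL + 1)) (size x)"
      unfolding poly_mult by (intro mult_mono le) simp_all
    then show "size (foldl (\<lambda>a _. CONS (CONS NIL (hd_sexp a)) a) (CONS NIL NIL) ys) \<le>
        poly ((pL + 1) * (pL + 1)) (size x)"
      using size[of "Suc (length ys)"] unfolding foldl_indices by linarith
  qed (intro polytime_cons polytime_hd polytime_tl polytime_id polytime_const)
qed

section \<open>Consistent families of partial colorings\<close>

text \<open>
  The winning condition of the pebble game. The tuples have pebbles on all positions at all times, and
  a move takes one pebble to a new vertex. For tuples of a fixed length this single condition replaces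
  the usual pair of closure under restriction and extension.
\<close>

definition extendable :: "'v set \<Rightarrow> ('v \<times> 'c) list set \<Rightarrow> bool" where
  "extendable V P \<longleftrightarrow> (\<forall>p\<in>P. \<forall>j<length p. \<forall>v\<in>V. \<exists>c. p[j := (v, c)] \<in> P)"

text \<open>
  The atoms in \<open>K\<close> occupy at most \<open>card K\<close> chosen positions, so some other position is free to be
  overwritten, even though every position carries an atom.
\<close>

lemma extendable_forth:
  assumes ext: "extendable V P" and p: "p \<in> P" and K: "K \<subseteq> set p" "card K < length p" and v: "v \<in> V"
  shows "\<exists>c. \<exists>q\<in>P. insert (v, c) K \<subseteq> set q \<and> length q = length p"
proof -
  have "\<forall>a\<in>K. \<exists>i<length p. p ! i = a" using K(1) by (auto simp: in_set_conv_nth subset_iff)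
  then obtain pos where pos: "\<And>a. a \<in> K \<Longrightarrow> pos a < length p \<and> p ! pos a = a" by metis
  have "finite K" using K(1) finite_subset by blast
  then have "card (pos ` K) < card {..<length p}"
    using card_image_le[of K pos] K(2) by simp
  then have "\<not> {..<length p} \<subseteq> pos ` K"
    using card_mono[of "pos ` K" "{..<length p}"] \<open>finite K\<close> by fastforce
  then obtain j where j: "j < length p" "j \<notin> pos ` K" by blast
  obtain c where c: "p[j := (v, c)] \<in> P" using ext p j(1) v unfolding extendable_def by blast
  have "a \<in> set (p[j := (v, c)])" if "a \<in> K" for a
  proof -
    have "p[j := (v, c)] ! pos a = a" using pos[OF that] j(2) that by (metis image_eqI nth_list_update_neq)
    then show ?thesis using pos[OF that] by (metis length_list_update nth_mem)
  qed
  moreover have "(v, c) \<in> set (p[j := (v, c)])" using j(1) by (simp add: set_update_memI)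
  ultimately have "insert (v, c) K \<subseteq> set (p[j := (v, c)])" by blast
  then show ?thesis using c by (metis length_list_update)
qed

lemma extendable_forth_set:
  assumes ext: "extendable V P" and p: "p \<in> P" and K: "K \<subseteq> set p"
    and D: "finite D" "D \<subseteq> V" "card K + card D \<le> length p"
  shows "\<exists>g. \<exists>q\<in>P. K \<union> (\<lambda>v. (v, g v)) ` D \<subseteq> set q"
proof -
  have "\<exists>g q. q \<in> P \<and> length q = length p \<and> K \<union> (\<lambda>v. (v, g v)) ` D \<subseteq> set q"
    using D
  proof (induction D rule: finite_induct)
    case empty
    then show ?case using p K by auto
  next
    case (insert x D)
    then obtain g q where q: "q \<in> P" "length q = length p" "K \<union> (\<lambda>v. (v, g v)) ` D \<subseteq> set q"
      by auto
    have "finite K" using K finite_subset by blast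
    have "card (K \<union> (\<lambda>v. (v, g v)) ` D) \<le> card K + card D"
      using card_Un_le[of K "(\<lambda>v. (v, g v)) ` D"] card_image_le[OF insert.hyps(1), of "\<lambda>v. (v, g v)"]
      by linarith
    then have "card (K \<union> (\<lambda>v. (v, g v)) ` D) < length q"
      using insert.prems insert.hyps q(2) by simp
    then obtain c q' where q': "q' \<in> P" "insert (x, c) (K \<union> (\<lambda>v. (v, g v)) ` D) \<subseteq> set q'"
      "length q' = length q"
      using extendable_forth[OF ext q(1) q(3), of x] insert.prems by blast
    have "(\<lambda>v. (v, (g(x := c)) v)) ` insert x D = insert (x, c) ((\<lambda>v. (v, g v)) ` D)"
      using insert.hyps by auto
    then show ?case using q' q(2) by (intro exI[of _ "g(x := c)"] exI[of _ q']) auto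
  qed
  then show ?thesis by blast
qed

section \<open>Tree decompositions\<close>

text \<open>
  A way around the edge would contain a path, of length at least 2, which the edge closes to a cycle.
\<close>

lemma undirected_tree_bridge:
  assumes T: "undirected_tree T" and st: "(s, t) \<in> parcs T"
  shows "(t, s) \<notin> (parcs T - {(s, t), (t, s)})\<^sup>*"
proof
  assume ts: "(t, s) \<in> (parcs T - {(s, t), (t, s)})\<^sup>*"
  interpret T: pair_graph T using T by (simp add: undirected_tree_def)
  let ?H = "\<lparr>pverts = pverts T, parcs = parcs T - {(s, t), (t, s)}\<rparr>"
  interpret H: pair_wf_digraph ?H
    by unfold_locales (use T.in_arcsD1 T.in_arcsD2 in auto)
  have verts: "s \<in> pverts T" "t \<in> pverts T" "s \<noteq> t"
    using st T.in_arcsD1 T.in_arcsD2 T.no_loops' by auto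
  have "t \<rightarrow>\<^sup>*\<^bsub>with_proj ?H\<^esub> s"
    unfolding reachable_def
    by (rule rtrancl_consistent_rtrancl_on) (use ts verts T.in_arcsD2 in auto)
  then obtain p where "H.apath t p s" using H.reachable_apath by auto
  then have p: "set p \<subseteq> parcs ?H" "pcas t p s" "distinct (pawalk_verts t p)"
    unfolding H.apath_def H.awalk_def by auto
  have "T.awalk s ((s, t) # p) s"
    unfolding T.awalk_def using p st verts by auto
  then have "T.cycle ((s, t) # p)"
    unfolding T.cycle_def using p(3) by auto
  moreover have "3 \<le> length ((s, t) # p)"
  proof (cases p)
    case Nil
    then show ?thesis using p(2) verts by simp
  next
    case (Cons e p')
    then show ?thesis using p by (cases p') (auto simp: prod_eq_iff)
  qed
  ultimately show False using T unfolding undirected_tree_def by blast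
qed

lemma connected_induced_rtrancl:
  assumes T: "pair_graph T" and con: "Digraph_Component.connected (with_proj T \<restriction> X)" and ab: "a \<in> X" "b \<in> X"
  shows "(a, b) \<in> (parcs T \<inter> X \<times> X)\<^sup>*"
proof -
  interpret T: pair_graph T by fact
  \<comment> \<open>By definition, connectedness refers to the symmetric closure; \<open>T\<close> is symmetric already.\<close>
  let ?M = "mk_symmetric (with_proj T \<restriction> X)"
  have "strongly_connected (with_proj ?M)" using con unfolding connected_def .
  moreover have "a \<in> verts (with_proj ?M)" "b \<in> verts (with_proj ?M)"
    using ab by (simp_all add: mk_symmetric_def induce_subgraph_def)
  ultimately have "a \<rightarrow>\<^sup>*\<^bsub>with_proj ?M\<^esub> b" unfolding strongly_connected_def by blast
  from reachable_rtranclI[OF this] have "(a, b) \<in> (parcs ?M)\<^sup>*" by simp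
  moreover have "parcs ?M \<subseteq> parcs T \<inter> X \<times> X"
    using T.arcs_symmetric by (auto simp: mk_symmetric_def induce_subgraph_def)
  ultimately show ?thesis using rtrancl_mono by blast
qed

lemma connected_rtrancl:
  assumes T: "pair_graph T" and con: "Digraph_Component.connected (with_proj T)"
    and ab: "a \<in> pverts T" "b \<in> pverts T"
  shows "(a, b) \<in> (parcs T)\<^sup>*"
proof -
  interpret T: pair_graph T by fact
  have "with_proj T \<restriction> pverts T = with_proj T"
    using T.in_arcsD1 T.in_arcsD2 by (auto simp: induce_subgraph_def with_proj_def)
  then have "(a, b) \<in> (parcs T \<inter> pverts T \<times> pverts T)\<^sup>*"
    using connected_induced_rtrancl[OF T _ ab] con by simp
  then show ?thesis using rtrancl_mono[of "parcs T \<inter> pverts T \<times> pverts T" "parcs T"] by blast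
qed

text \<open>
  The running intersection property along an edge \<open>st\<close> leaving a connected set \<open>S\<close> of nodes. Otherwise
  the connected set of nodes whose bags contain \<open>v\<close> would lead from \<open>t\<close> back into \<open>S\<close> without
  passing through \<open>s\<close>, and from there one reaches \<open>s\<close> inside \<open>S\<close>. The edge \<open>st\<close> would not be a bridge.
\<close>

lemma tree_decomposition_separation:
  assumes td: "tree_decomposition G T B"
    and S: "\<And>r. r \<in> S \<Longrightarrow> (r, s) \<in> (parcs T \<inter> S \<times> S)\<^sup>*" "S \<subseteq> pverts T"
    and st: "(s, t) \<in> parcs T" "s \<in> S" "t \<notin> S"
    and r: "r \<in> S" "v \<in> B r" "v \<in> B t"
  shows "v \<in> B s"
proof (rule ccontr)
  assume vs: "v \<notin> B s"
  have T: "undirected_tree T" "pair_graph T"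
    using td by (simp_all add: tree_decomposition_def undirected_tree_def)
  interpret T: pair_graph T by fact
  let ?X = "{t \<in> pverts T. v \<in> B t}"
  let ?R = "parcs T - {(s, t), (t, s)}"
  have "t \<in> ?X" "r \<in> ?X" using r S(2) st(1) T.in_arcsD2 by auto
  moreover have "v \<in> pverts G" using td calculation unfolding tree_decomposition_def by blast
  then have "Digraph_Component.connected (with_proj T \<restriction> ?X)"
    using td unfolding tree_decomposition_def by blast
  ultimately have "(t, r) \<in> (parcs T \<inter> ?X \<times> ?X)\<^sup>*"
    by (intro connected_induced_rtrancl[OF T(2)])
  moreover have "parcs T \<inter> ?X \<times> ?X \<subseteq> ?R" using vs by auto
  ultimately have "(t, r) \<in> ?R\<^sup>*" using rtrancl_mono by blast
  moreover have "parcs T \<inter> S \<times> S \<subseteq> ?R" using st(3) by auto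
  then have "(r, s) \<in> ?R\<^sup>*" using S(1)[OF r(1)] rtrancl_mono by blast
  ultimately have "(t, s) \<in> ?R\<^sup>*" by (rule rtrancl_trans)
  then show False using undirected_tree_bridge[OF T(1) st(1)] by blast
qed

lemma rtrancl_crossing:
  assumes "(a, b) \<in> R\<^sup>*" "a \<in> S" "b \<notin> S"
  obtains s t where "(s, t) \<in> R" "s \<in> S" "t \<notin> S"
  using assms by (induction rule: rtrancl_induct) blast+

text \<open>
  The heart of the completeness proof. A connected set \<open>S\<close> of nodes is enlarged node by node, together
  with a coloring \<open>c\<close> such that the coloring of every bag of \<open>S\<close> lies in some tuple of \<open>P\<close>. If the new
  node \<open>t\<close> is a neighbor of \<open>s \<in> S\<close>, one starts from the tuple for \<open>B s\<close>, keeps its pebbles on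
  \<open>B t \<inter> B s\<close> and moves the others to the remaining vertices of \<open>B t\<close>; as the bag has at most \<open>d\<close>
  vertices there are enough pebbles. The newly colored vertices occur in no earlier bag by the
  running intersection property, so the colors chosen before stay valid.
\<close>

lemma extendable_tree_decomposition:
  fixes P :: "('a \<times> 'c) list set"
  assumes td: "tree_decomposition G T B" and G: "pair_graph G"
    and bags: "\<And>t. t \<in> pverts T \<Longrightarrow> card (B t) \<le> d"
    and ext: "extendable (pverts G) P" and P: "P \<noteq> {}" "\<And>p. p \<in> P \<Longrightarrow> length p = d"
  obtains c where "\<And>t. t \<in> pverts T \<Longrightarrow> \<exists>p\<in>P. (\<lambda>v. (v, c v)) ` B t \<subseteq> set p"
proof -
  interpret G: pair_graph G by fact
  have T: "undirected_tree T" "pair_graph T" "Digraph_Component.connected (with_proj T)"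
    using td by (simp_all add: tree_decomposition_def undirected_tree_def)
  interpret T: pair_graph T by fact
  have BV: "B t \<subseteq> pverts G" if "t \<in> pverts T" for t
    using td that unfolding tree_decomposition_def by blast
  then have finB: "finite (B t)" if "t \<in> pverts T" for t
    using that finite_subset G.pair_finite_verts by blast
  have ne: "pverts T \<noteq> {}" using T(3)
    unfolding connected_def strongly_connected_def by (simp add: mk_symmetric_def)
  define good where "good S \<longleftrightarrow> S \<subseteq> pverts T \<and> (\<forall>r\<in>S. \<forall>r'\<in>S. (r, r') \<in> (parcs T \<inter> S \<times> S)\<^sup>*) \<and>
    (\<exists>c. \<forall>t\<in>S. \<exists>p\<in>P. (\<lambda>v. (v, c v :: 'c)) ` B t \<subseteq> set p)" for S
  have "\<exists>S. card S = Suc n \<and> good S" if "Suc n \<le> card (pverts T)" for n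
    using that
  proof (induction n)
    case 0
    obtain t where t: "t \<in> pverts T" using ne by blast
    obtain p where p: "p \<in> P" using P(1) by blast
    have "card ({} :: ('a \<times> 'c) set) + card (B t) \<le> length p" using bags[OF t] P(2)[OF p] by simp
    from extendable_forth_set[OF ext p empty_subsetI finB[OF t] BV[OF t] this]
    have "good {t}" using t unfolding good_def by simp
    then show ?case by (intro exI[of _ "{t}"]) simp
  next
    case (Suc n)
    then obtain S where S: "card S = Suc n" "good S" by auto
    then obtain c where c: "\<And>t. t \<in> S \<Longrightarrow> \<exists>p\<in>P. (\<lambda>v. (v, c v :: 'c)) ` B t \<subseteq> set p"
      unfolding good_def by blast
    have SV: "S \<subseteq> pverts T" and Scon: "\<And>r r'. r \<in> S \<Longrightarrow> r' \<in> S \<Longrightarrow> (r, r') \<in> (parcs T \<inter> S \<times> S)\<^sup>*"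
      using S(2) unfolding good_def by blast+
    obtain a where a: "a \<in> S" using S(1) by (metis card.empty ex_in_conv nat.distinct(1))
    have "\<not> pverts T \<subseteq> S" using S(1) Suc.prems SV
      by (metis Suc_n_not_le_n subset_antisym)
    then obtain b where b: "b \<in> pverts T" "b \<notin> S" by blast
    have "(a, b) \<in> (parcs T)\<^sup>*" using connected_rtrancl[OF T(2,3)] a b SV by blast
    then obtain s t where st: "(s, t) \<in> parcs T" "s \<in> S" "t \<notin> S"
      by (rule rtrancl_crossing[OF _ a b(2)])
    have t: "t \<in> pverts T" and s: "s \<in> pverts T" and ts: "(t, s) \<in> parcs T"
      using st(1) T.in_arcsD1 T.in_arcsD2 T.arcs_symmetric by blast+
    have sep: "v \<in> B s" if "r \<in> S" "v \<in> B r" "v \<in> B t" for r v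
      using tree_decomposition_separation[OF td _ SV st that] Scon st(2) by blast
    obtain p where p: "p \<in> P" "(\<lambda>v. (v, c v)) ` B s \<subseteq> set p" using c[OF st(2)] by blast
    \<comment> \<open>\<open>?K\<close> are the atoms to keep, \<open>?D\<close> the vertices that need a pebble.\<close>
    let ?K = "(\<lambda>v. (v, c v)) ` (B t \<inter> B s)" and ?D = "B t - B s"
    have "card ?K \<le> card (B t \<inter> B s)" using finB[OF t] by (intro card_image_le) simp
    then have "card ?K + card ?D \<le> length p"
      using bags[OF t] P(2)[OF p(1)] finB[OF t] card_Diff_subset_Int[of "B t" "B s"]
        card_mono[of "B t" "B t \<inter> B s"] by simp
    moreover have "?K \<subseteq> set p" using p(2) by blast
    ultimately have "\<exists>g. \<exists>q\<in>P. ?K \<union> (\<lambda>v. (v, g v)) ` ?D \<subseteq> set q"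
      using finB[OF t] BV[OF t] by (intro extendable_forth_set[OF ext p(1)]) auto
    then obtain g q where q: "q \<in> P" "?K \<union> (\<lambda>v. (v, g v)) ` ?D \<subseteq> set q" by blast
    define c' where "c' v = (if v \<in> ?D then g v else c v)" for v
    have "\<exists>p\<in>P. (\<lambda>v. (v, c' v)) ` B r \<subseteq> set p" if r: "r \<in> insert t S" for r
    proof (cases "r = t")
      case True
      have "(v, c' v) \<in> set q" if "v \<in> B t" for v
        using q(2) that by (cases "v \<in> B s") (auto simp: c'_def image_subset_iff)
      then have "(\<lambda>v. (v, c' v)) ` B t \<subseteq> set q" by blast
      then show ?thesis using True q(1) by blast
    next
      case False
      then have rS: "r \<in> S" using r by simp
      have "c' v = c v" if "v \<in> B r" for v using sep[OF rS that] by (auto simp: c'_def)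
      then show ?thesis using c[OF rS] by (auto simp: image_def)
    qed
    moreover have "(r, r') \<in> (parcs T \<inter> insert t S \<times> insert t S)\<^sup>*"
      if "r \<in> insert t S" "r' \<in> insert t S" for r r'
    proof -
      let ?R = "(parcs T \<inter> insert t S \<times> insert t S)\<^sup>*"
      have mono: "(parcs T \<inter> S \<times> S)\<^sup>* \<subseteq> ?R" by (intro rtrancl_mono) auto
      have edge: "(t, s) \<in> ?R" "(s, t) \<in> ?R"
        by (rule r_into_rtrancl, use ts st in simp)+
      have 1: "(r, s) \<in> ?R" if "r \<in> insert t S" for r
        using that Scon[of r s] mono edge st(2) by blast
      have 2: "(s, r) \<in> ?R" if "r \<in> insert t S" for r
        using that Scon[of s r] mono edge st(2) by blast
      show ?thesis using rtrancl_trans[OF 1[OF that(1)] 2[OF that(2)]] .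
    qed
    ultimately have "good (insert t S)" using SV t unfolding good_def by blast
    moreover have "card (insert t S) = Suc (Suc n)"
      using S(1) st(3) by (metis card_insert_disjoint card.infinite nat.distinct(1))
    ultimately show ?case by blast
  qed
  moreover obtain n where n: "card (pverts T) = Suc n"
    using ne T.pair_finite_verts by (metis card_0_eq not0_implies_Suc)
  ultimately obtain S where S: "card S = card (pverts T)" "good S" by auto
  then have "S = pverts T" unfolding good_def
    by (meson T.pair_finite_verts card_subset_eq)
  then show ?thesis using S(2) that unfolding good_def by blast
qed

text \<open>
  The treewidth is defined as a least element; this shows that it is attained.
\<close>

lemma ex_tree_decomposition:
  assumes G: "pair_graph G"
  shows "\<exists>T B. tree_decomposition G T B"
proof -
  interpret G: pair_graph G by fact
  let ?T = "\<lparr>pverts = {0 :: nat}, parcs = {}\<rparr>"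
  have pg: "pair_graph ?T"
    by unfold_locales (auto simp: symmetric_def sym_def)
  interpret T: pair_graph ?T by fact
  have con: "Digraph_Component.connected (with_proj ?T)" "Digraph_Component.connected (with_proj ?T \<restriction> {0})"
    unfolding connected_def strongly_connected_def reachable_def
    by (auto simp: mk_symmetric_def induce_subgraph_def)
  moreover have "\<not> T.cycle p" for p
    unfolding T.cycle_def T.awalk_def by auto
  ultimately have "undirected_tree ?T" using pg unfolding undirected_tree_def by blast
  moreover have "{t \<in> pverts ?T. v \<in> pverts G} = {0}" if "v \<in> pverts G" for v using that by auto
  ultimately have "tree_decomposition G ?T (\<lambda>_. pverts G)"
    unfolding tree_decomposition_def using con G.in_arcsD1 G.in_arcsD2 by auto
  then show ?thesis by blast
qed

lemma treewidth_tree_decomposition: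
  assumes G: "pair_graph G" and tw: "treewidth G \<le> w"
  obtains T B where "tree_decomposition G T B" "\<And>t. t \<in> pverts T \<Longrightarrow> card (B t) \<le> Suc w"
proof -
  have "\<exists>w T B. tree_decomposition G T B \<and> width T B = w"
    using ex_tree_decomposition[OF G] by blast
  from LeastI_ex[OF this] obtain T B where td: "tree_decomposition G T B"
    and "width T B = treewidth G" unfolding treewidth_def by blast
  then have w: "width T B \<le> w" using tw by simp
  have "finite (pverts T)"
    using td unfolding tree_decomposition_def undirected_tree_def
    by (meson pair_fin_digraph.pair_finite_verts pair_graph.axioms(1) pair_digraph.axioms(1))
  then have "card (B t) \<le> Max ((\<lambda>t. card (B t)) ` pverts T)" if "t \<in> pverts T" for t
    using that by (intro Max_ge) simp_all
  moreover have "Max ((\<lambda>t. card (B t)) ` pverts T) \<le> Suc w"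
    using w unfolding width_def by linarith
  ultimately have "card (B t) \<le> Suc w" if "t \<in> pverts T" for t
    using that le_trans by blast
  with td show ?thesis by (rule that)
qed

lemma clique_number_le:
  assumes G: "pair_graph G" and C: "\<And>C. clique G C \<Longrightarrow> card C \<le> k"
  shows "clique_number G \<le> k"
proof -
  interpret G: pair_graph G by fact
  have "{card C | C. clique G C} \<subseteq> card ` Pow (pverts G)" unfolding clique_def by auto
  then have "finite {card C | C. clique G C}"
    by (rule finite_subset) (simp add: G.pair_finite_verts)
  moreover have "clique G {}" by (simp add: clique_def)
  ultimately show ?thesis unfolding clique_number_def using C by (intro Max.boundedI) auto
qed

section \<open>The greatest extendable subfamily\<close>

definition core :: "'v set \<Rightarrow> ('v \<times> 'c) list set \<Rightarrow> ('v \<times> 'c) list set" where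
  "core V P = \<Union>{S. S \<subseteq> P \<and> extendable V S}"

lemma core_subset: "core V P \<subseteq> P"
  unfolding core_def by blast

lemma extendable_core: "extendable V (core V P)"
  unfolding extendable_def core_def by blast

lemma core_greatest: "S \<subseteq> P \<Longrightarrow> extendable V S \<Longrightarrow> S \<subseteq> core V P"
  unfolding core_def by blast

lemma core_mono: "P \<subseteq> Q \<Longrightarrow> core V P \<subseteq> core V Q"
  using core_subset extendable_core core_greatest by (metis subset_trans)

text \<open>
  After a further restriction of the admissible tuples, pruning may start from the family
  already computed instead of from scratch.
\<close>

lemma core_Int_core:
  assumes "Q \<subseteq> P"
  shows "core V (core V P \<inter> Q) = core V Q"
  using core_mono[of "core V P \<inter> Q" Q V] core_mono[OF assms, of V] core_subset[of V Q]
    core_greatest[OF _ extendable_core, of V Q "core V P \<inter> Q"] by blast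

definition prune :: "'v set \<Rightarrow> ('v \<times> 'c) list set \<Rightarrow> ('v \<times> 'c) list set" where
  "prune V P = {p \<in> P. \<forall>j<length p. \<forall>v\<in>V. \<exists>c. p[j := (v, c)] \<in> P}"

text \<open>
  A round of pruning that changes the family removes a tuple, and no round removes a tuple of an
  extendable subfamily. So after \<open>card P\<close> rounds the family is stable, and equal to the core.
\<close>

lemma prune_funpow_card:
  assumes "finite P" "card P \<le> n"
  shows "(prune V ^^ n) P = core V P"
  using assms
proof (induction n arbitrary: P)
  case 0
  then show ?case using core_subset[of V P] by simp
next
  case (Suc n)
  have sub: "prune V P \<subseteq> P" unfolding prune_def by blast
  show ?case
  proof (cases "prune V P = P")
    case True
    then have "extendable V P" unfolding extendable_def prune_def by blast
    then have "core V P = P" using core_subset[of V P] core_greatest[of P P V] by blast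
    moreover have "(prune V ^^ m) P = P" for m using True by (induction m) auto
    ultimately show ?thesis by metis
  next
    case False
    then have "card (prune V P) < card P" using sub Suc.prems(1) by (intro psubset_card_mono) auto
    then have "(prune V ^^ n) (prune V P) = core V (prune V P)"
      using Suc.prems sub finite_subset by (intro Suc.IH) auto
    moreover have "core V P \<subseteq> prune V P"
      using core_subset[of V P] extendable_core[of V P] unfolding prune_def extendable_def by blast
    then have "core V (prune V P) = core V P"
      using core_mono[OF sub, of V] core_greatest[OF _ extendable_core, of V P "prune V P"] by blast
    ultimately show ?thesis by (simp add: funpow_swap1 del: funpow.simps add: funpow_Suc_right)
  qed
qed

section \<open>Consistency of list coloring instances\<close>

definition consistent_tuples :: "nat \<Rightarrow> 'a pair_pre_digraph \<Rightarrow> ('a \<Rightarrow> nat set) \<Rightarrow> ('a \<times> nat) list set" where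
  "consistent_tuples d G L = {p. length p = d \<and> (\<forall>(v, i)\<in>set p. v \<in> pverts G \<and> i \<in> L v) \<and>
     (\<forall>(u, i)\<in>set p. \<forall>(v, j)\<in>set p. (u, v) \<in> parcs G \<longrightarrow> i \<noteq> j)}"

abbreviation consistency_core :: "nat \<Rightarrow> 'a pair_pre_digraph \<Rightarrow> ('a \<Rightarrow> nat set) \<Rightarrow> ('a \<times> nat) list set" where
  "consistency_core d G L \<equiv> core (pverts G) (consistent_tuples d G L)"

definition consistent :: "nat \<Rightarrow> 'a pair_pre_digraph \<Rightarrow> ('a \<Rightarrow> nat set) \<Rightarrow> bool" where
  "consistent d G L \<longleftrightarrow> consistency_core d G L \<noteq> {}"

lemma consistent_tuples_mono:
  "(\<And>v. L v \<subseteq> L' v) \<Longrightarrow> consistent_tuples d G L \<subseteq> consistent_tuples d G L'"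
  unfolding consistent_tuples_def by fast

lemma consistency_coreD:
  assumes "p \<in> consistency_core d G L"
  shows "length p = d" "(v, i) \<in> set p \<Longrightarrow> v \<in> pverts G \<and> i \<in> L v"
    "(u, i) \<in> set p \<Longrightarrow> (v, j) \<in> set p \<Longrightarrow> (u, v) \<in> parcs G \<Longrightarrow> i \<noteq> j"
  using assms core_subset[of "pverts G" "consistent_tuples d G L"] unfolding consistent_tuples_def by blast+

text \<open>
  The tuples of atoms \<open>(v, c v)\<close> of a list coloring \<open>c\<close> are an extendable family. A vertex is needed
  for this family to be nonempty.
\<close>

lemma list_colorable_imp_consistent:
  assumes "list_colorable G L" "pverts G \<noteq> {}"
  shows "consistent d G L"
proof -
  obtain c where c: "\<And>v. v \<in> pverts G \<Longrightarrow> c v \<in> L v" "\<And>u v. (u, v) \<in> parcs G \<Longrightarrow> c u \<noteq> c v"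
    using assms(1) unfolding list_colorable_def by blast
  let ?P = "{p. length p = d \<and> set p \<subseteq> (\<lambda>v. (v, c v)) ` pverts G}"
  have "p \<in> consistent_tuples d G L" if "p \<in> ?P" for p
  proof -
    have "v \<in> pverts G \<and> i = c v" if "(v, i) \<in> set p" for v i
      using \<open>p \<in> ?P\<close> that by blast
    then show ?thesis using \<open>p \<in> ?P\<close> c unfolding consistent_tuples_def by blast
  qed
  then have "?P \<subseteq> consistent_tuples d G L" by (rule subsetI)
  moreover have "p[j := (v, c v)] \<in> ?P" if "p \<in> ?P" "v \<in> pverts G" for p j v
    using that set_update_subset_insert[of p j "(v, c v)"] by auto
  then have "extendable (pverts G) ?P" unfolding extendable_def by blast
  ultimately have "?P \<subseteq> consistency_core d G L" by (rule core_greatest)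
  moreover obtain v where "v \<in> pverts G" using assms(2) by blast
  then have "replicate d (v, c v) \<in> ?P" by auto
  ultimately show ?thesis unfolding consistent_def by blast
qed

lemma consistent_imp_list_colorable:
  assumes G: "pair_graph G" and con: "consistent d G L"
    and td: "tree_decomposition G T B" "\<And>t. t \<in> pverts T \<Longrightarrow> card (B t) \<le> d"
  shows "list_colorable G L"
proof -
  obtain c where c: "\<And>t. t \<in> pverts T \<Longrightarrow> \<exists>p\<in>consistency_core d G L. (\<lambda>v. (v, c v)) ` B t \<subseteq> set p"
    using extendable_tree_decomposition[OF td(1) G td(2) extendable_core con[unfolded consistent_def]]
      consistency_coreD(1) by blast
  show ?thesis unfolding list_colorable_def
  proof (intro exI[of _ c] conjI ballI)
    fix v assume "v \<in> pverts G"
    then obtain t where "t \<in> pverts T" "v \<in> B t" using td(1) unfolding tree_decomposition_def by blast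
    then obtain p where p: "p \<in> consistency_core d G L" "(v, c v) \<in> set p" using c[of t] by blast
    show "c v \<in> L v" using consistency_coreD(2)[OF p] by simp
  next
    fix e assume "e \<in> parcs G"
    then obtain t where t: "t \<in> pverts T" "fst e \<in> B t" "snd e \<in> B t"
      using td(1) unfolding tree_decomposition_def by fastforce
    then obtain p where p: "p \<in> consistency_core d G L" "(fst e, c (fst e)) \<in> set p" "(snd e, c (snd e)) \<in> set p"
      using c[of t] by blast
    show "case e of (u, v) \<Rightarrow> c u \<noteq> c v"
      using consistency_coreD(3)[OF p] \<open>e \<in> parcs G\<close> by (simp add: case_prod_beta)
  qed
qed

text \<open>
  A clique with \<open>k + 1 \<le> d\<close> vertices could be colored within a single tuple, hence with distinct
  colors, but there are only \<open>k\<close> of them.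
\<close>

lemma consistent_imp_clique_le:
  assumes G: "pair_graph G" and con: "consistent d G L" and L: "\<And>v. v \<in> pverts G \<Longrightarrow> L v \<subseteq> {1..k}"
    and d: "k < d" and C: "clique G C"
  shows "card C \<le> k"
proof (rule ccontr)
  assume "\<not> card C \<le> k"
  then obtain D where D: "D \<subseteq> C" "card D = Suc k" "finite D"
    by (meson obtain_subset_with_card_n Suc_leI not_le)
  then have DV: "D \<subseteq> pverts G" using C unfolding clique_def by blast
  obtain p where p: "p \<in> consistency_core d G L" using con unfolding consistent_def by blast
  have "\<exists>g. \<exists>q\<in>consistency_core d G L. {} \<union> (\<lambda>v. (v, g v)) ` D \<subseteq> set q"
    using D d consistency_coreD(1)[OF p]
    by (intro extendable_forth_set[OF extendable_core p _ _ DV]) auto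
  then obtain g q where q: "q \<in> consistency_core d G L" "(\<lambda>v. (v, g v)) ` D \<subseteq> set q" by auto
  have "inj_on g D"
  proof (rule inj_onI, rule ccontr)
    fix u v assume uv: "u \<in> D" "v \<in> D" "g u = g v" "u \<noteq> v"
    then have "(u, v) \<in> parcs G" using C D(1) unfolding clique_def by blast
    then show False using consistency_coreD(3)[OF q(1), of u "g u" v "g v"] q(2) uv by blast
  qed
  moreover have "g ` D \<subseteq> {1..k}"
    using consistency_coreD(2)[OF q(1)] q(2) L DV by blast
  ultimately have "card D \<le> card {1..k}" by (intro card_inj_on_le) auto
  then show False using D(2) by simp
qed

text \<open>
  With two pebbles one can reach both ends of any edge, starting from any tuple, and the resulting
  tuple can only contain the unique colors of the two ends. This works in every graph, whatever its
  treewidth.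
\<close>

lemma consistent_singletons_imp_list_colorable:
  assumes G: "pair_graph G" and con: "consistent d G L" and d: "2 \<le> d"
    and single: "\<And>v i j. v \<in> pverts G \<Longrightarrow> i \<in> L v \<Longrightarrow> j \<in> L v \<Longrightarrow> i = j"
  shows "list_colorable G L"
proof -
  interpret G: pair_graph G by fact
  let ?P = "consistency_core d G L"
  obtain p where p: "p \<in> ?P" using con unfolding consistent_def by blast
  define c where "c v = (SOME i. i \<in> L v)" for v
  have two: "\<exists>i j q. q \<in> ?P \<and> (u, i) \<in> set q \<and> (v, j) \<in> set q" if "u \<in> pverts G" "v \<in> pverts G" for u v
  proof -
    have "card ({} :: ('a \<times> nat) set) < length p" using consistency_coreD(1)[OF p] d by simp
    from extendable_forth[OF extendable_core p empty_subsetI this that(1)]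
    obtain i q where q: "q \<in> ?P" "{(u, i)} \<subseteq> set q" "length q = length p" by blast
    have "card {(u, i)} < length q" using q(3) consistency_coreD(1)[OF p] d by simp
    from extendable_forth[OF extendable_core q(1,2) this that(2)] show ?thesis by blast
  qed
  have cL: "c v \<in> L v" if v: "v \<in> pverts G" for v
  proof -
    obtain i q where q: "q \<in> ?P" "(v, i) \<in> set q" using two[OF v v] by blast
    show ?thesis using consistency_coreD(2)[OF q] unfolding c_def by (metis someI_ex)
  qed
  have "c u \<noteq> c v" if uv: "(u, v) \<in> parcs G" for u v
  proof -
    have V: "u \<in> pverts G" "v \<in> pverts G" using uv G.in_arcsD1 G.in_arcsD2 by auto
    then obtain i j q where q: "q \<in> ?P" "(u, i) \<in> set q" "(v, j) \<in> set q" using two by blast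
    have "i = c u" using consistency_coreD(2)[OF q(1,2)] single cL V(1) by blast
    moreover have "j = c v" using consistency_coreD(2)[OF q(1,3)] single cL V(2) by blast
    ultimately show ?thesis using consistency_coreD(3)[OF q uv] by simp
  qed
  with cL show ?thesis unfolding list_colorable_def by blast
qed

section \<open>Deciding one color after the other\<close>

definition fix_color :: "('a \<Rightarrow> nat set) \<Rightarrow> 'a \<times> nat \<Rightarrow> 'a \<Rightarrow> nat set" where
  "fix_color L a = L(fst a := L (fst a) \<inter> {snd a})"

definition forbid_color :: "('a \<Rightarrow> nat set) \<Rightarrow> 'a \<times> nat \<Rightarrow> 'a \<Rightarrow> nat set" where
  "forbid_color L a = L(fst a := L (fst a) - {snd a})"

lemma fix_color_subset: "fix_color L a v \<subseteq> L v"
  by (auto simp: fix_color_def)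

lemma forbid_color_subset: "forbid_color L a v \<subseteq> L v"
  by (auto simp: forbid_color_def)

text \<open>
  The color is forbidden without testing whether this keeps the instance consistent: if neither
  choice does, no later one restores consistency, and the failure shows in the final test.
\<close>

definition narrow :: "nat \<Rightarrow> 'a pair_pre_digraph \<Rightarrow> ('a \<Rightarrow> nat set) \<Rightarrow> 'a \<times> nat \<Rightarrow> 'a \<Rightarrow> nat set" where
  "narrow d G L a = (if consistent d G (fix_color L a) then fix_color L a else forbid_color L a)"

lemma narrow_subset: "narrow d G L a v \<subseteq> L v"
  by (simp add: narrow_def fix_color_subset forbid_color_subset)

lemma foldl_narrow_subset: "foldl (narrow d G) L as v \<subseteq> L v"
proof (induction as arbitrary: L)
  case (Cons a as)
  then show ?case using narrow_subset[of d G L a v] by fastforce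
qed simp

text \<open>
  Once \<open>(v, i)\<close> has been treated, \<open>i\<close> is either the only color left for \<open>v\<close> or not available for \<open>v\<close>.
\<close>

lemma foldl_narrow_decided:
  assumes "(v, i) \<in> set as" "i \<in> foldl (narrow d G) L as v" "j \<in> foldl (narrow d G) L as v"
  shows "i = j"
  using assms
proof (induction as arbitrary: L)
  case (Cons a as)
  show ?case
  proof (cases "a = (v, i)")
    case True
    have "i \<in> narrow d G L a v" "j \<in> narrow d G L a v"
      using Cons.prems(2,3) foldl_narrow_subset[of d G "narrow d G L a" as v] by auto
    then show ?thesis using True
      by (auto simp: narrow_def fix_color_def forbid_color_def split: if_splits)
  next
    case False
    then show ?thesis using Cons by auto
  qed
qed simp

text \<open>
  If the test is right about the instance with the prescribed color, narrowing preserves colorability: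
  a color that occurs at its vertex in no list coloring may be forbidden.
\<close>

lemma narrow_list_colorable:
  assumes col: "list_colorable G L" and con: "\<not> list_colorable G (fix_color L a) \<Longrightarrow> \<not> consistent d G (fix_color L a)"
    and ne: "pverts G \<noteq> {}"
  shows "list_colorable G (narrow d G L a)"
proof (cases "list_colorable G (fix_color L a)")
  case True
  then show ?thesis using list_colorable_imp_consistent[OF True ne] by (simp add: narrow_def)
next
  case False
  obtain c where c: "\<And>v. v \<in> pverts G \<Longrightarrow> c v \<in> L v" "\<forall>(u, v)\<in>parcs G. c u \<noteq> c v"
    using col unfolding list_colorable_def by blast
  have "\<not> (\<forall>v\<in>pverts G. c v \<in> fix_color L a v)" using False c(2) unfolding list_colorable_def by blast
  then have "c (fst a) \<noteq> snd a" using c(1) by (auto simp: fix_color_def split: if_splits)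
  then have "\<forall>v\<in>pverts G. c v \<in> forbid_color L a v" using c(1) by (auto simp: forbid_color_def)
  then have "list_colorable G (forbid_color L a)" using c(2) unfolding list_colorable_def by blast
  then show ?thesis using con[OF False] by (simp add: narrow_def)
qed

lemma foldl_narrow_list_colorable:
  assumes "\<And>L. consistent d G L \<Longrightarrow> list_colorable G L" "pverts G \<noteq> {}" "list_colorable G L"
  shows "list_colorable G (foldl (narrow d G) L as)"
  using assms(3)
proof (induction as arbitrary: L)
  case (Cons a as)
  have "list_colorable G (narrow d G L a)"
    by (rule narrow_list_colorable[OF Cons.prems _ assms(2)]) (use assms(1) in blast)
  then show ?case using Cons.IH by simp
qed simp

lemma list_colorable_mono:
  "list_colorable G L \<Longrightarrow> (\<And>v. v \<in> pverts G \<Longrightarrow> L v \<subseteq> L' v) \<Longrightarrow> list_colorable G L'"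
  unfolding list_colorable_def by blast

lemma consistent_foldl_narrow_imp_list_colorable:
  assumes G: "pair_graph G" and d: "2 \<le> d"
    and as: "\<And>v i. v \<in> pverts G \<Longrightarrow> i \<in> L v \<Longrightarrow> (v, i) \<in> set as"
    and con: "consistent d G (foldl (narrow d G) L as)"
  shows "list_colorable G L"
proof (rule list_colorable_mono)
  show "list_colorable G (foldl (narrow d G) L as)"
  proof (rule consistent_singletons_imp_list_colorable[OF G con d])
    fix v i j
    assume v: "v \<in> pverts G" and i: "i \<in> foldl (narrow d G) L as v" and j: "j \<in> foldl (narrow d G) L as v"
    have "(v, i) \<in> set as" using as[OF v] i foldl_narrow_subset[of d G L as v] by blast
    then show "i = j" using i j by (rule foldl_narrow_decided)
  qed
qed (rule foldl_narrow_subset)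

section \<open>The consistency algorithm on trees\<close>

text \<open>
  Trees for the objects of the previous sections: an atom is a pair of unary numerals, for the position
  of the vertex in the ordering and for the predecessor of the color, a tuple is a list of atoms, and a family is a list of tuples. The instance is \<open>I\<close>, with the adjacency matrix as head and
  the lists of colors as tail.
\<close>

definition component :: "nat \<Rightarrow> sexp \<Rightarrow> sexp" where
  "component j p = hd_sexp ((tl_sexp ^^ j) p)"

definition same_atom :: "sexp \<Rightarrow> sexp \<Rightarrow> bool" where
  "same_atom a b \<longleftrightarrow> len_tree (hd_sexp a) = len_tree (hd_sexp b) \<and> len_tree (tl_sexp a) = len_tree (tl_sexp b)"

definition adjacent :: "sexp \<Rightarrow> sexp \<Rightarrow> sexp \<Rightarrow> bool" where
  "adjacent I u v \<longleftrightarrow> nth_tree (nth_tree (hd_sexp I) u) v \<noteq> NIL"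

definition allowed :: "sexp \<Rightarrow> sexp \<Rightarrow> sexp \<Rightarrow> bool" where
  "allowed I v i \<longleftrightarrow> nth_tree (nth_tree (tl_sexp I) v) i \<noteq> NIL"

definition atoms :: "nat \<Rightarrow> sexp \<Rightarrow> sexp" where
  "atoms k I = concat_map (\<lambda>v. concat_map (\<lambda>i. if allowed I v i then CONS (CONS v i) NIL else NIL)
     (enc_list (map enc_nat [0..<k]))) (indices (hd_sexp I))"

fun tuples :: "nat \<Rightarrow> sexp \<Rightarrow> sexp" where
  "tuples 0 A = CONS NIL NIL"
| "tuples (Suc d) A = concat_map (\<lambda>p. concat_map (\<lambda>a. CONS (CONS a p) NIL) A) (tuples d A)"

definition proper_tuple :: "nat \<Rightarrow> sexp \<Rightarrow> sexp \<Rightarrow> bool" where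
  "proper_tuple d I p \<longleftrightarrow> (\<forall>j<d. \<forall>l<d.
     adjacent I (hd_sexp (component j p)) (hd_sexp (component l p)) \<longrightarrow>
     \<not> len_tree (tl_sexp (component j p)) = len_tree (tl_sexp (component l p)))"

definition replaceable :: "nat \<Rightarrow> sexp \<Rightarrow> sexp \<Rightarrow> sexp \<Rightarrow> bool" where
  "replaceable d p X I \<longleftrightarrow> (\<forall>j<d. \<forall>v\<in>set (dec_list (indices (hd_sexp I))). \<exists>q\<in>set (dec_list X).
     len_tree (hd_sexp (component j q)) = len_tree v \<and> (\<forall>l<d. l \<noteq> j \<longrightarrow> same_atom (component l q) (component l p)))"

definition prune_tree :: "nat \<Rightarrow> sexp \<Rightarrow> sexp \<Rightarrow> sexp" where
  "prune_tree d X I = filter_tree (\<lambda>p. replaceable d p X I) X"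

text \<open>
  As many rounds of pruning as there are tuples, by \<open>prune_funpow_card\<close>.
\<close>

definition core_tree :: "nat \<Rightarrow> sexp \<Rightarrow> sexp \<Rightarrow> sexp" where
  "core_tree d X I = foldl (\<lambda>Y _. prune_tree d Y I) X (dec_list X)"

definition fix_tree :: "nat \<Rightarrow> sexp \<Rightarrow> sexp \<Rightarrow> sexp" where
  "fix_tree d a X = filter_tree (\<lambda>p. \<forall>j<d. len_tree (hd_sexp (component j p)) = len_tree (hd_sexp a) \<longrightarrow>
     len_tree (tl_sexp (component j p)) = len_tree (tl_sexp a)) X"

definition forbid_tree :: "nat \<Rightarrow> sexp \<Rightarrow> sexp \<Rightarrow> sexp" where
  "forbid_tree d a X = filter_tree (\<lambda>p. \<forall>j<d. \<not> same_atom (component j p) a) X"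

definition narrow_tree :: "nat \<Rightarrow> sexp \<Rightarrow> sexp \<Rightarrow> sexp \<Rightarrow> sexp" where
  "narrow_tree d X a I = (if core_tree d (fix_tree d a X) I \<noteq> NIL then core_tree d (fix_tree d a X) I
     else core_tree d (forbid_tree d a X) I)"

definition initial_core :: "nat \<Rightarrow> nat \<Rightarrow> sexp \<Rightarrow> sexp" where
  "initial_core k d I = core_tree d (filter_tree (\<lambda>p. proper_tuple d I p) (tuples d (atoms k I))) I"

text \<open>
  The graph without vertices is treated separately, because it has no tuples and would count as
  inconsistent.
\<close>

definition solve :: "nat \<Rightarrow> nat \<Rightarrow> sexp \<Rightarrow> sexp" where
  "solve k d I =
    (if hd_sexp I \<noteq> NIL then
       if initial_core k d I \<noteq> NIL then
         if foldl (\<lambda>X a. narrow_tree d X a I) (initial_core k d I) (dec_list (atoms k I)) \<noteq> NIL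
         then enc_answer Yes else enc_answer Not_In_Class
       else enc_answer No
     else enc_answer Yes)"

section \<open>Polynomial running time\<close>

lemma polytime_tl_funpow: "polytime F \<Longrightarrow> polytime (\<lambda>x. (tl_sexp ^^ j) (F x))"
  by (induction j) (simp_all add: polytime_tl)

lemma polytime_component: "polytime F \<Longrightarrow> polytime (\<lambda>x. component j (F x))"
  unfolding component_def by (intro polytime_hd polytime_tl_funpow)

lemma polytime_same_atom:
  assumes "polytime F" "polytime G"
  shows "polytime (\<lambda>x. enc_bool (same_atom (F x) (G x)))"
  unfolding same_atom_def by (intro polytime_conj polytime_len_tree_eq polytime_hd polytime_tl assms)

lemma polytime_adjacent:
  assumes "polytime I" "polytime U" "polytime V"
  shows "polytime (\<lambda>x. enc_bool (adjacent (I x) (U x) (V x)))"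
  unfolding adjacent_def by (intro polytime_nonempty polytime_nth_tree polytime_hd assms)

lemma polytime_allowed:
  assumes "polytime I" "polytime U" "polytime V"
  shows "polytime (\<lambda>x. enc_bool (allowed (I x) (U x) (V x)))"
  unfolding allowed_def by (intro polytime_nonempty polytime_nth_tree polytime_tl assms)

lemma polytime_atoms: "polytime (atoms k)"
  unfolding atoms_def
  by (intro polytime_concat_map polytime_if polytime_allowed polytime_cons polytime_indices
      polytime_hd polytime_tl polytime_id polytime_const)

lemma polytime_tuples:
  assumes "polytime A"
  shows "polytime (\<lambda>x. tuples d (A x))"
proof -
  have "polytime (tuples d)"
  proof (induction d)
    case (Suc d)
    then show ?case unfolding tuples.simps
      by (intro polytime_concat_map polytime_cons polytime_hd polytime_tl polytime_id polytime_const)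
  qed (simp add: polytime_const)
  then show ?thesis using assms by (rule polytime_comp)
qed

lemma polytime_proper_tuple:
  assumes "polytime I" "polytime P"
  shows "polytime (\<lambda>x. enc_bool (proper_tuple d (I x) (P x)))"
  unfolding proper_tuple_def
  by (intro polytime_all_less polytime_imp polytime_not polytime_adjacent polytime_len_tree_eq
      polytime_component polytime_hd polytime_tl assms)

lemma polytime_imp_const:
  assumes "polytime (\<lambda>x. enc_bool (P x))"
  shows "polytime (\<lambda>x. enc_bool (b \<longrightarrow> P x))"
  by (rule polytime_imp[OF polytime_const assms])

lemma polytime_replaceable:
  "polytime (\<lambda>z. enc_bool (replaceable d (hd_sexp z) (hd_sexp (tl_sexp z)) (tl_sexp (tl_sexp z))))"
  unfolding replaceable_def
  by (intro polytime_all_less polytime_Ball polytime_Bex polytime_conj polytime_imp_const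
      polytime_len_tree_eq polytime_same_atom polytime_component polytime_indices polytime_hd polytime_tl polytime_id)

lemma polytime_prune_tree: "polytime (\<lambda>z. prune_tree d (hd_sexp z) (tl_sexp z))"
  unfolding prune_tree_def
  by (intro polytime_filter_tree polytime_replaceable polytime_hd polytime_id)

lemma size_prune_tree: "size (prune_tree d X I) \<le> size X"
  unfolding prune_tree_def by (rule size_filter_tree)

lemma size_core_tree: "size (core_tree d X I) \<le> size X"
proof -
  have "size (foldl (\<lambda>Y _. prune_tree d Y I) X ys) \<le> size X" for ys :: "sexp list"
    by (induction ys arbitrary: X) (auto intro: le_trans size_prune_tree)
  then show ?thesis by (simp add: core_tree_def)
qed

lemma polytime_core_tree:
  assumes "polytime X" "polytime I"
  shows "polytime (\<lambda>x. core_tree d (X x) (I x))"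
proof (rule polytime_env[OF _ assms])
  show "polytime (\<lambda>z. core_tree d (hd_sexp z) (tl_sexp z))"
    unfolding core_tree_def
  proof (rule polytime_foldl[where r = 0])
    show "polytime (\<lambda>z. prune_tree d (hd_sexp z) (tl_sexp (tl_sexp (tl_sexp z))))"
      by (rule polytime_env[OF polytime_prune_tree]) (intro polytime_hd polytime_tl polytime_id)+
  qed (auto simp: size_prune_tree polytime_hd polytime_id)
qed

lemma polytime_fix_tree:
  assumes "polytime A" "polytime X"
  shows "polytime (\<lambda>x. fix_tree d (A x) (X x))"
proof (rule polytime_env[OF _ assms])
  show "polytime (\<lambda>z. fix_tree d (hd_sexp z) (tl_sexp z))" unfolding fix_tree_def
    by (intro polytime_filter_tree polytime_all_less polytime_imp polytime_len_tree_eq polytime_component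
        polytime_hd polytime_tl polytime_id)
qed

lemma polytime_forbid_tree:
  assumes "polytime A" "polytime X"
  shows "polytime (\<lambda>x. forbid_tree d (A x) (X x))"
proof (rule polytime_env[OF _ assms])
  show "polytime (\<lambda>z. forbid_tree d (hd_sexp z) (tl_sexp z))" unfolding forbid_tree_def
    by (intro polytime_filter_tree polytime_all_less polytime_not polytime_same_atom polytime_component
        polytime_hd polytime_tl polytime_id)
qed

lemma size_narrow_tree: "size (narrow_tree d X a I) \<le> size X"
  unfolding narrow_tree_def fix_tree_def forbid_tree_def by (auto intro: le_trans[OF size_core_tree] size_filter_tree)

lemma polytime_initial_core: "polytime (initial_core k d)"
  unfolding initial_core_def
  by (intro polytime_core_tree polytime_filter_tree polytime_proper_tuple polytime_tuples polytime_atoms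
      polytime_hd polytime_tl polytime_id)

lemma polytime_solve: "polytime (solve k d)"
proof -
  have "polytime (\<lambda>I. foldl (\<lambda>X a. narrow_tree d X a I) (initial_core k d I) (dec_list (atoms k I)))"
  proof (rule polytime_foldl[where r = 0, OF polytime_atoms polytime_initial_core])
    show "polytime (\<lambda>z. narrow_tree d (hd_sexp z) (hd_sexp (tl_sexp z)) (tl_sexp (tl_sexp z)))"
      unfolding narrow_tree_def
      by (intro polytime_cond polytime_core_tree polytime_fix_tree polytime_forbid_tree polytime_hd polytime_tl polytime_id)
  qed (simp add: size_narrow_tree)
  then show ?thesis unfolding solve_def
    by (intro polytime_cond polytime_const polytime_initial_core polytime_hd polytime_id)
qed

lemma polytime_run:
  assumes "polytime F"
  obtains c p where "\<And>x. \<exists>t. run c x t (F x) \<and> t \<le> poly p (size x)"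
proof -
  obtain p c where c: "computes c 0 F p" using assms unfolding polytime_def by blast
  have "\<exists>t. run c x t (F x) \<and> t \<le> poly p (size x)" for x
  proof -
    let ?s = "(\<lambda>_. NIL)(0 := x) :: store"
    obtain t s' where "exec c ?s t s'" "s' 0 = F (?s 0)" "t \<le> poly p (size (?s 0))"
      using c[unfolded computes_def, THEN spec, of ?s] by (elim exE conjE) (rule that)
    then show ?thesis unfolding run_def by (intro exI[of _ t]) auto
  qed
  then show ?thesis by (rule that)
qed

section \<open>Correctness of the algorithm\<close>

lemma component_nth:
  assumes "j < len_tree p"
  shows "component j p = dec_list p ! j"
proof -
  have "dec_list ((tl_sexp ^^ j) p) = drop j (dec_list p)"
    by (induction j) (simp_all add: drop_Suc tl_drop)
  then have "dec_list ((tl_sexp ^^ j) p) = dec_list p ! j # drop (Suc j) (dec_list p)"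
    using assms by (simp add: len_tree_def Cons_nth_drop_Suc)
  then show ?thesis unfolding component_def by (cases "(tl_sexp ^^ j) p") auto
qed

locale encoded_instance =
  fixes k :: nat and G :: "'a pair_pre_digraph" and L :: "'a \<Rightarrow> nat set" and vs :: "'a list"
  assumes inst: "list_coloring_instance k G L" and ordering: "vertex_ordering G vs"
begin

definition input_tree :: sexp where "input_tree = enc_instance k G L vs"

text \<open>
  Colors are numbered from 1 and positions from 0, hence the successor. Many trees decode to the same
  atom; as the algorithm inspects them only through their lengths, no canonical form is required.
\<close>

definition dec_atom :: "sexp \<Rightarrow> 'a \<times> nat" where
  "dec_atom a = (vs ! len_tree (hd_sexp a), Suc (len_tree (tl_sexp a)))"

definition dec_tuple :: "sexp \<Rightarrow> ('a \<times> nat) list" where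
  "dec_tuple p = map dec_atom (dec_list p)"

definition is_atom :: "sexp \<Rightarrow> bool" where
  "is_atom a \<longleftrightarrow> len_tree (hd_sexp a) < length vs"

definition represents :: "nat \<Rightarrow> sexp \<Rightarrow> ('a \<times> nat) list set \<Rightarrow> bool" where
  "represents d X P \<longleftrightarrow> (\<forall>p\<in>set (dec_list X). len_tree p = d \<and> (\<forall>a\<in>set (dec_list p). is_atom a)) \<and>
     dec_tuple ` set (dec_list X) = P"

lemma vs: "distinct vs" "set vs = pverts G" and graph: "pair_graph G"
  and lists: "v \<in> pverts G \<Longrightarrow> L v \<subseteq> {1..k}"
  using inst ordering by (auto simp: vertex_ordering_def list_coloring_instance_def)

lemma len_tree_adjacency: "len_tree (hd_sexp input_tree) = length vs"
  by (simp add: input_tree_def enc_instance_def len_tree_def)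

lemma adjacent_iff:
  assumes "len_tree u < length vs" "len_tree v < length vs"
  shows "adjacent input_tree u v \<longleftrightarrow> (vs ! len_tree u, vs ! len_tree v) \<in> parcs G"
proof -
  have "enc_bool b \<noteq> NIL \<longleftrightarrow> b" for b by (cases b) auto
  then show ?thesis using assms by (simp add: adjacent_def input_tree_def enc_instance_def nth_tree_enc_list)
qed

lemma allowed_iff:
  assumes "len_tree v < length vs" "len_tree i < k"
  shows "allowed input_tree v i \<longleftrightarrow> Suc (len_tree i) \<in> L (vs ! len_tree v)"
proof -
  have "enc_bool b \<noteq> NIL \<longleftrightarrow> b" for b by (cases b) auto
  then show ?thesis using assms by (simp add: allowed_def input_tree_def enc_instance_def nth_tree_enc_list del: upt_Suc)
qed

lemma set_indices_input_tree: "set (dec_list (indices (hd_sexp input_tree))) = enc_nat ` {..<length vs}"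
  by (simp add: set_indices len_tree_adjacency)

lemma same_atom_iff:
  assumes "is_atom a" "is_atom b"
  shows "same_atom a b \<longleftrightarrow> dec_atom a = dec_atom b"
  using assms nth_eq_iff_index_eq[OF vs(1)] by (auto simp: same_atom_def dec_atom_def is_atom_def)

lemma representsD:
  assumes "represents d X P" "p \<in> set (dec_list X)"
  shows "len_tree p = d" "length (dec_tuple p) = d" "dec_tuple p \<in> P"
    "j < d \<Longrightarrow> is_atom (component j p)" "j < d \<Longrightarrow> dec_tuple p ! j = dec_atom (component j p)"
proof -
  show 1: "len_tree p = d" and "dec_tuple p \<in> P" using assms by (auto simp: represents_def)
  then show "length (dec_tuple p) = d" by (simp add: dec_tuple_def len_tree_def)
  show "is_atom (component j p)" if "j < d"
    using assms 1 that component_nth[of j p] by (auto simp: represents_def len_tree_def)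
  show "dec_tuple p ! j = dec_atom (component j p)" if "j < d"
    using 1 that component_nth[of j p] by (simp add: dec_tuple_def len_tree_def)
qed

lemma represents_nonempty: "represents d X P \<Longrightarrow> X \<noteq> NIL \<longleftrightarrow> P \<noteq> {}"
  by (auto simp: represents_def)

text \<open>
  Filtering is the only operation that the algorithm applies to families, so correctness of the
  predicates is all that remains to be checked.
\<close>

lemma represents_filter_tree:
  assumes X: "represents d X P"
    and eq: "\<And>p. p \<in> set (dec_list X) \<Longrightarrow> \<phi> p \<longleftrightarrow> dec_tuple p \<in> Q"
  shows "represents d (filter_tree \<phi> X) (P \<inter> Q)"
  using X eq unfolding represents_def by auto

lemma represents_prune_tree:
  assumes X: "represents d X P"
  shows "represents d (prune_tree d X input_tree) (prune (pverts G) P)"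
proof -
  have "replaceable d p X input_tree \<longleftrightarrow>
      dec_tuple p \<in> {p. \<forall>j<length p. \<forall>v\<in>pverts G. \<exists>c. p[j := (v, c)] \<in> P}"
    if p: "p \<in> set (dec_list X)" for p
  proof -
    have "(\<exists>q\<in>set (dec_list X). len_tree (hd_sexp (component j q)) = i \<and>
        (\<forall>l<d. l \<noteq> j \<longrightarrow> same_atom (component l q) (component l p))) \<longleftrightarrow>
      (\<exists>c. (dec_tuple p)[j := (vs ! i, c)] \<in> P)" (is "?A \<longleftrightarrow> ?B")
      if j: "j < d" and i: "i < length vs" for i j
    proof
      assume ?A
      then obtain q where q: "q \<in> set (dec_list X)" "len_tree (hd_sexp (component j q)) = i"
        "\<And>l. l < d \<Longrightarrow> l \<noteq> j \<Longrightarrow> same_atom (component l q) (component l p)" by blast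
      have "(dec_tuple p)[j := (vs ! i, snd (dec_tuple q ! j))] = dec_tuple q"
      proof (rule nth_equalityI)
        fix l assume "l < length ((dec_tuple p)[j := (vs ! i, snd (dec_tuple q ! j))])"
        then have l: "l < d" using representsD(2)[OF X p] by simp
        show "(dec_tuple p)[j := (vs ! i, snd (dec_tuple q ! j))] ! l = dec_tuple q ! l"
        proof (cases "l = j")
          case True
          then show ?thesis
            using l q(2) representsD(2)[OF X p] representsD(5)[OF X q(1) l] by (simp add: dec_atom_def)
        next
          case False
          then show ?thesis
            using q(3)[OF l False] same_atom_iff representsD(4,5)[OF X p l] representsD(4,5)[OF X q(1) l]
            by simp
        qed
      qed (simp add: representsD(2)[OF X p] representsD(2)[OF X q(1)])
      then show ?B using representsD(3)[OF X q(1)] by metis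
    next
      assume ?B
      then obtain c where "(dec_tuple p)[j := (vs ! i, c)] \<in> P" by blast
      then obtain q where q: "q \<in> set (dec_list X)" "dec_tuple q = (dec_tuple p)[j := (vs ! i, c)]"
        using X unfolding represents_def by (metis imageE)
      have "same_atom (component l q) (component l p)" if "l < d" "l \<noteq> j" for l
        using that same_atom_iff representsD(4,5)[OF X p] representsD(4,5)[OF X q(1)] q(2)
        by (metis nth_list_update_neq)
      moreover have "len_tree (hd_sexp (component j q)) = i"
      proof -
        have "dec_atom (component j q) = (vs ! i, c)"
          using representsD(5)[OF X q(1) j] representsD(2)[OF X p] q(2) j by simp
        then show ?thesis
          using representsD(4)[OF X q(1) j] nth_eq_iff_index_eq[OF vs(1) _ i]
          by (simp add: dec_atom_def is_atom_def)
      qed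
      ultimately show ?A using q(1) by blast
    qed
    moreover have "(\<forall>v\<in>pverts G. R v) \<longleftrightarrow> (\<forall>i<length vs. R (vs ! i))" for R
      unfolding vs(2)[symmetric] by (simp add: all_set_conv_all_nth)
    ultimately show ?thesis
      unfolding replaceable_def set_indices_input_tree using representsD(2)[OF X p]
      by simp (simp add: Ball_def)
  qed
  from represents_filter_tree[OF X this] show ?thesis
    unfolding prune_tree_def prune_def by (simp add: Int_def)
qed

lemma represents_core_tree:
  assumes X: "represents d X P"
  shows "represents d (core_tree d X input_tree) (core (pverts G) P)"
proof -
  have "represents d (foldl (\<lambda>Y _. prune_tree d Y input_tree) X ys) ((prune (pverts G) ^^ length ys) P)"
    for ys :: "sexp list"
    by (induction ys rule: rev_induct) (simp_all add: X represents_prune_tree)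
  moreover have "P = dec_tuple ` set (dec_list X)" using X by (simp add: represents_def)
  then have "finite P" "card P \<le> length (dec_list X)"
    using card_image_le[of "set (dec_list X)" dec_tuple] card_length[of "dec_list X"] by auto
  ultimately show ?thesis unfolding core_tree_def by (metis prune_funpow_card)
qed

lemma represents_fix_tree:
  assumes X: "represents d X (consistency_core d G L')" and a: "is_atom a"
  shows "represents d (fix_tree d a X)
    (consistency_core d G L' \<inter> consistent_tuples d G (fix_color L' (dec_atom a)))"
  unfolding fix_tree_def
proof (rule represents_filter_tree[OF X])
  fix p assume p: "p \<in> set (dec_list X)"
  have core: "dec_tuple p \<in> consistency_core d G L'" by (rule representsD(3)[OF X p])
  have eq: "len_tree (hd_sexp (component j p)) = len_tree (hd_sexp a) \<longleftrightarrow>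
      fst (dec_tuple p ! j) = fst (dec_atom a)"
    "len_tree (tl_sexp (component j p)) = len_tree (tl_sexp a) \<longleftrightarrow>
      snd (dec_tuple p ! j) = snd (dec_atom a)" if "j < d" for j
    using representsD(4,5)[OF X p that] a nth_eq_iff_index_eq[OF vs(1)]
    by (simp_all add: dec_atom_def is_atom_def)
  have "(\<forall>j<d. len_tree (hd_sexp (component j p)) = len_tree (hd_sexp a) \<longrightarrow>
      len_tree (tl_sexp (component j p)) = len_tree (tl_sexp a)) \<longleftrightarrow>
    (\<forall>b\<in>set (dec_tuple p). fst b = fst (dec_atom a) \<longrightarrow> snd b = snd (dec_atom a))"
    using eq representsD(2)[OF X p] by (simp add: all_set_conv_all_nth)
  also have "\<dots> \<longleftrightarrow> dec_tuple p \<in> consistent_tuples d G (fix_color L' (dec_atom a))"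
    using core core_subset[of "pverts G" "consistent_tuples d G L'"]
    by (fastforce simp: consistent_tuples_def fix_color_def)
  finally show "(\<forall>j<d. len_tree (hd_sexp (component j p)) = len_tree (hd_sexp a) \<longrightarrow>
      len_tree (tl_sexp (component j p)) = len_tree (tl_sexp a)) \<longleftrightarrow>
    dec_tuple p \<in> consistent_tuples d G (fix_color L' (dec_atom a))" .
qed

lemma represents_forbid_tree:
  assumes X: "represents d X (consistency_core d G L')" and a: "is_atom a"
  shows "represents d (forbid_tree d a X)
    (consistency_core d G L' \<inter> consistent_tuples d G (forbid_color L' (dec_atom a)))"
  unfolding forbid_tree_def
proof (rule represents_filter_tree[OF X])
  fix p assume p: "p \<in> set (dec_list X)"
  have core: "dec_tuple p \<in> consistency_core d G L'" by (rule representsD(3)[OF X p])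
  have "(\<forall>j<d. \<not> same_atom (component j p) a) \<longleftrightarrow> dec_atom a \<notin> set (dec_tuple p)"
    using representsD(2,4,5)[OF X p] same_atom_iff[OF _ a] by (auto simp: in_set_conv_nth)
  also have "\<dots> \<longleftrightarrow> dec_tuple p \<in> consistent_tuples d G (forbid_color L' (dec_atom a))"
    using core core_subset[of "pverts G" "consistent_tuples d G L'"]
    by (fastforce simp: consistent_tuples_def forbid_color_def)
  finally show "(\<forall>j<d. \<not> same_atom (component j p) a) \<longleftrightarrow>
    dec_tuple p \<in> consistent_tuples d G (forbid_color L' (dec_atom a))" .
qed

text \<open>
  The list in the program always represents the core for the current list assignment \<open>L'\<close>; the
  assignment itself is not stored.
\<close>

lemma represents_narrow_tree:
  assumes X: "represents d X (consistency_core d G L')" and a: "is_atom a"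
  shows "represents d (narrow_tree d X a input_tree) (consistency_core d G (narrow d G L' (dec_atom a)))"
proof -
  have sub: "consistent_tuples d G (fix_color L' (dec_atom a)) \<subseteq> consistent_tuples d G L'"
    "consistent_tuples d G (forbid_color L' (dec_atom a)) \<subseteq> consistent_tuples d G L'"
    by (rule consistent_tuples_mono, rule fix_color_subset forbid_color_subset)+
  note core_fix = represents_core_tree[OF represents_fix_tree[OF X a], unfolded core_Int_core[OF sub(1)]]
  note core_forbid = represents_core_tree[OF represents_forbid_tree[OF X a], unfolded core_Int_core[OF sub(2)]]
  show ?thesis
    using core_fix core_forbid represents_nonempty[OF core_fix] by (simp add: narrow_tree_def narrow_def consistent_def)
qed

lemma set_atoms:
  "set (dec_list (atoms k input_tree)) =
    {CONS (enc_nat n) (enc_nat i) | n i. n < length vs \<and> i < k \<and> Suc i \<in> L (vs ! n)}"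
proof (intro equalityI subsetI)
  fix a assume "a \<in> set (dec_list (atoms k input_tree))"
  then obtain n i where ni: "n < length vs" "i < k" "allowed input_tree (enc_nat n) (enc_nat i)"
    "a = CONS (enc_nat n) (enc_nat i)"
    unfolding atoms_def set_concat_map set_indices_input_tree by (auto split: if_splits)
  then show "a \<in> {CONS (enc_nat n) (enc_nat i) | n i. n < length vs \<and> i < k \<and> Suc i \<in> L (vs ! n)}"
    by (auto simp: allowed_iff)
next
  fix a assume "a \<in> {CONS (enc_nat n) (enc_nat i) | n i. n < length vs \<and> i < k \<and> Suc i \<in> L (vs ! n)}"
  then obtain n i where ni: "n < length vs" "i < k" "Suc i \<in> L (vs ! n)"
    "a = CONS (enc_nat n) (enc_nat i)" by blast
  then have "allowed input_tree (enc_nat n) (enc_nat i)" by (simp add: allowed_iff)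
  then show "a \<in> set (dec_list (atoms k input_tree))"
    unfolding atoms_def set_concat_map set_indices_input_tree using ni
    by (intro UN_I[of "enc_nat n"] UN_I[of "enc_nat i"]) auto
qed

lemma is_atom_atoms: "a \<in> set (dec_list (atoms k input_tree)) \<Longrightarrow> is_atom a"
  unfolding set_atoms by (auto simp: is_atom_def)

lemma dec_atom_atoms: "dec_atom ` set (dec_list (atoms k input_tree)) = {(v, i). v \<in> pverts G \<and> i \<in> L v}"
proof (intro equalityI subsetI)
  fix x assume "x \<in> {(v, i). v \<in> pverts G \<and> i \<in> L v}"
  then obtain v i where x: "x = (v, i)" "v \<in> pverts G" "i \<in> L v" by blast
  obtain n where n: "n < length vs" "v = vs ! n" using x(2) vs(2) by (metis in_set_conv_nth)
  have "0 < i" "i \<le> k" using lists[OF x(2)] x(3) by auto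
  then have "CONS (enc_nat n) (enc_nat (i - 1)) \<in> set (dec_list (atoms k input_tree))"
    unfolding set_atoms using n x by fastforce
  moreover have "dec_atom (CONS (enc_nat n) (enc_nat (i - 1))) = x"
    using n x \<open>0 < i\<close> by (simp add: dec_atom_def)
  ultimately show "x \<in> dec_atom ` set (dec_list (atoms k input_tree))" by blast
qed (auto simp: set_atoms dec_atom_def vs(2)[symmetric])

lemma set_tuples:
  "set (dec_list (tuples d A)) = enc_list ` {xs. length xs = d \<and> set xs \<subseteq> set (dec_list A)}"
proof (induction d)
  case 0
  have "{xs. length xs = 0 \<and> set xs \<subseteq> set (dec_list A)} = {[]}" by auto
  then show ?case by simp
next
  case (Suc d)
  show ?case
  proof (intro equalityI subsetI)
    fix p assume "p \<in> set (dec_list (tuples (Suc d) A))"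
    then obtain a xs where "p = CONS a (enc_list xs)" "a \<in> set (dec_list A)" "length xs = d"
      "set xs \<subseteq> set (dec_list A)"
      by (auto simp: set_concat_map Suc.IH)
    then show "p \<in> enc_list ` {xs. length xs = Suc d \<and> set xs \<subseteq> set (dec_list A)}"
      by (intro image_eqI[of _ _ "a # xs"]) auto
  next
    fix p assume "p \<in> enc_list ` {xs. length xs = Suc d \<and> set xs \<subseteq> set (dec_list A)}"
    then obtain a xs where "p = CONS a (enc_list xs)" "a \<in> set (dec_list A)" "length xs = d"
      "set xs \<subseteq> set (dec_list A)"
      by (auto simp: length_Suc_conv)
    then show "p \<in> set (dec_list (tuples (Suc d) A))"
      by (auto simp: set_concat_map Suc.IH)
  qed
qed

lemma represents_initial_core:
  "represents d (initial_core k d input_tree) (consistency_core d G L)"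
proof -
  let ?T = "{t. length t = d \<and> set t \<subseteq> {(v, i). v \<in> pverts G \<and> i \<in> L v}}"
  have T: "represents d (tuples d (atoms k input_tree)) ?T"
    unfolding represents_def
  proof
    show "\<forall>p\<in>set (dec_list (tuples d (atoms k input_tree))). len_tree p = d \<and> (\<forall>a\<in>set (dec_list p). is_atom a)"
      unfolding set_tuples using is_atom_atoms by (auto simp: len_tree_def)
    have "dec_tuple ` set (dec_list (tuples d (atoms k input_tree))) =
        map dec_atom ` {xs. length xs = d \<and> set xs \<subseteq> set (dec_list (atoms k input_tree))}"
      unfolding set_tuples by (simp add: dec_tuple_def image_image)
    also have "\<dots> = {t. length t = d \<and> set t \<subseteq> dec_atom ` set (dec_list (atoms k input_tree))}"
    proof (intro equalityI subsetI)
      fix t assume t: "t \<in> {t. length t = d \<and> set t \<subseteq> dec_atom ` set (dec_list (atoms k input_tree))}"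
      then have "t \<in> map dec_atom ` lists (set (dec_list (atoms k input_tree)))"
        by (simp only: lists_image[symmetric]) (auto simp: in_lists_conv_set)
      then show "t \<in> map dec_atom ` {xs. length xs = d \<and> set xs \<subseteq> set (dec_list (atoms k input_tree))}"
        using t by (auto simp: in_lists_conv_set)
    next
      fix t assume "t \<in> map dec_atom ` {xs. length xs = d \<and> set xs \<subseteq> set (dec_list (atoms k input_tree))}"
      then obtain xs where xs: "t = map dec_atom xs" "length xs = d" "set xs \<subseteq> set (dec_list (atoms k input_tree))"
        by blast
      then show "t \<in> {t. length t = d \<and> set t \<subseteq> dec_atom ` set (dec_list (atoms k input_tree))}"
        using image_mono[OF xs(3), of dec_atom] by simp
    qed
    finally show "dec_tuple ` set (dec_list (tuples d (atoms k input_tree))) = ?T"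
      unfolding dec_atom_atoms .
  qed
  let ?Q = "{p. \<forall>(u, i)\<in>set p. \<forall>(v, j)\<in>set p. (u, v) \<in> parcs G \<longrightarrow> i \<noteq> j}"
  have "represents d (filter_tree (\<lambda>p. proper_tuple d input_tree p) (tuples d (atoms k input_tree))) (?T \<inter> ?Q)"
  proof (rule represents_filter_tree[OF T])
    fix p assume p: "p \<in> set (dec_list (tuples d (atoms k input_tree)))"
    have "adjacent input_tree (hd_sexp (component j p)) (hd_sexp (component l p)) \<longleftrightarrow>
        (fst (dec_tuple p ! j), fst (dec_tuple p ! l)) \<in> parcs G" if "j < d" "l < d" for j l
      using representsD(4,5)[OF T p] that adjacent_iff by (simp add: is_atom_def dec_atom_def)
    moreover have "len_tree (tl_sexp (component j p)) = len_tree (tl_sexp (component l p)) \<longleftrightarrow>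
        snd (dec_tuple p ! j) = snd (dec_tuple p ! l)" if "j < d" "l < d" for j l
      using representsD(5)[OF T p] that by (simp add: dec_atom_def)
    ultimately show "proper_tuple d input_tree p \<longleftrightarrow> dec_tuple p \<in> ?Q"
      using representsD(2)[OF T p]
      by (simp add: proper_tuple_def all_set_conv_all_nth case_prod_beta)
  qed
  moreover have "?T \<inter> ?Q = consistent_tuples d G L"
    unfolding consistent_tuples_def by blast
  ultimately show ?thesis unfolding initial_core_def by (metis represents_core_tree)
qed

text \<open>
  The class enters only through the treewidth bound, which is applied when the algorithm answers
  \<open>Not_In_Class\<close>. The clique number is known to be at most \<open>k\<close> then, because the initial instance
  was consistent.
\<close>

lemma solve_correct:
  assumes d: "2 \<le> d" "k < d"
    and in_class: "G \<in> \<G> \<Longrightarrow> clique_number G \<le> k \<Longrightarrow> treewidth G < d"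
  shows "\<exists>a. solve k d input_tree = enc_answer a \<and> correct_answer \<G> G L a"
proof (cases "pverts G = {}")
  case True
  interpret G: pair_graph G by (rule graph)
  have "parcs G = {}" using True G.in_arcsD1 by auto
  then have "list_colorable G L" using True unfolding list_colorable_def by simp
  moreover have "length vs = 0" using True vs(2) by simp
  then have "len_tree (hd_sexp input_tree) = 0" by (simp only: len_tree_adjacency)
  then have "hd_sexp input_tree = NIL" by (simp add: len_tree_def)
  ultimately show ?thesis by (intro exI[of _ Yes]) (simp add: solve_def)
next
  case False
  have "length vs \<noteq> 0" using False vs(2) by auto
  then have "len_tree (hd_sexp input_tree) \<noteq> 0" by (simp only: len_tree_adjacency not_False_eq_True)
  then have input_tree: "hd_sexp input_tree \<noteq> NIL" by (auto simp: len_tree_def)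
  note init = represents_initial_core[of d]
  show ?thesis
  proof (cases "consistent d G L")
    case False
    then have "\<not> list_colorable G L" using list_colorable_imp_consistent \<open>pverts G \<noteq> {}\<close> by blast
    then show ?thesis using False input_tree represents_nonempty[OF init]
      by (intro exI[of _ No]) (simp add: solve_def consistent_def)
  next
    case con: True
    let ?as = "dec_list (atoms k input_tree)"
    let ?X = "foldl (\<lambda>X a. narrow_tree d X a input_tree) (initial_core k d input_tree) ?as"
    let ?L = "foldl (narrow d G) L (map dec_atom ?as)"
    have rep: "represents d (foldl (\<lambda>X a. narrow_tree d X a input_tree) (initial_core k d input_tree) as)
        (consistency_core d G (foldl (narrow d G) L (map dec_atom as)))"
      if "set as \<subseteq> set ?as" for as
      using that by (induction as rule: rev_induct) (auto simp: init intro!: represents_narrow_tree is_atom_atoms)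
    have X: "?X \<noteq> NIL \<longleftrightarrow> consistent d G ?L"
      unfolding consistent_def by (rule represents_nonempty[OF rep]) simp
    have yes: "list_colorable G L" if "consistent d G ?L"
    proof (rule consistent_foldl_narrow_imp_list_colorable[OF graph d(1) _ that])
      show "(v, i) \<in> set (map dec_atom ?as)" if "v \<in> pverts G" "i \<in> L v" for v i
        unfolding set_map dec_atom_atoms using that by simp
    qed
    have not_in_class: "G \<notin> \<G>" if "\<not> consistent d G ?L"
    proof
      assume "G \<in> \<G>"
      moreover have "clique_number G \<le> k"
        using consistent_imp_clique_le[OF graph con lists d(2)] by (intro clique_number_le[OF graph]) auto
      ultimately have "treewidth G \<le> d - 1" using in_class by fastforce
      then obtain T B where td: "tree_decomposition G T B" "\<And>t. t \<in> pverts T \<Longrightarrow> card (B t) \<le> d"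
        using treewidth_tree_decomposition[OF graph] d(1) by (metis Suc_diff_1 gr0I not_numeral_le_zero)
      have col: "list_colorable G L'" if "consistent d G L'" for L'
        by (rule consistent_imp_list_colorable[OF graph that td])
      then have "list_colorable G ?L"
        by (rule foldl_narrow_list_colorable[OF _ False col[OF con]])
      then show False using list_colorable_imp_consistent[OF _ False] that by blast
    qed
    show ?thesis
    proof (cases "consistent d G ?L")
      case True
      then show ?thesis using X yes con input_tree represents_nonempty[OF init]
        by (intro exI[of _ Yes]) (simp add: solve_def consistent_def)
    next
      case False
      then show ?thesis using X not_in_class con input_tree represents_nonempty[OF init]
        by (intro exI[of _ Not_In_Class]) (simp add: solve_def consistent_def)
    qed
  qed
qed

end

theorem theorem6p3:
  fixes \<G> :: "'a pair_pre_digraph set" and f :: "nat \<Rightarrow> nat"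
  assumes "graph_class \<G>"
    and "tw_omega_bounded \<G>"
    and "tw_omega_binding_function f \<G>"
    and "computable f"
  shows "\<forall>k\<ge>1. \<exists>c. robust_list_coloring_algorithm k \<G> c \<and>
           polynomial_time_on (list_coloring_inputs TYPE('a) k) c"
proof (intro allI impI)
  fix k :: nat
  assume k: "1 \<le> k"
  \<comment> \<open>The sum bounds \<open>f\<close> on all clique numbers up to \<open>k\<close>; the summand \<open>k\<close> makes \<open>d\<close> exceed \<open>k\<close>, and \<open>k \<ge> 1\<close> gives \<open>d \<ge> 2\<close>.\<close>
  define d where "d = Suc (k + (\<Sum>i\<le>k. f i))"
  have tw: "treewidth G < d" if "G \<in> \<G>" "clique_number G \<le> k" for G
  proof -
    interpret pair_graph G using that(1) assms(1) by (simp add: graph_class_def)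
    have "induced_subgraph (with_proj G) (with_proj G)"
      using induced_subgraph_refl by simp
    then have "treewidth G \<le> f (clique_number G)"
      using assms(3) that(1) unfolding tw_omega_binding_function_def by blast
    also have "\<dots> \<le> (\<Sum>i\<le>k. f i)" using that(2) by (intro member_le_sum) auto
    finally show ?thesis by (simp add: d_def)
  qed
  obtain c p where c: "\<And>x. \<exists>t. run c x t (solve k d x) \<and> t \<le> poly p (size x)"
    using polytime_run[OF polytime_solve] by metis
  have "robust_list_coloring_algorithm k \<G> c"
    unfolding robust_list_coloring_algorithm_def
  proof (intro allI impI, elim conjE)
    fix G :: "'a pair_pre_digraph" and L vs
    assume "list_coloring_instance k G L" "vertex_ordering G vs"
    then interpret encoded_instance k G L vs by unfold_locales
    obtain a where "solve k d input_tree = enc_answer a" "correct_answer \<G> G L a"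
      using solve_correct[of d \<G>] tw k by (auto simp: d_def)
    then show "\<exists>t a. run c (enc_instance k G L vs) t (enc_answer a) \<and> correct_answer \<G> G L a"
      using c[of input_tree] unfolding input_tree_def by metis
  qed
  moreover have "polynomial_time_on X c" for X
    unfolding polynomial_time_on_def using c by blast
  ultimately show "\<exists>c. robust_list_coloring_algorithm k \<G> c \<and>
      polynomial_time_on (list_coloring_inputs TYPE('a) k) c" by blast
qed

end
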